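(* For each of the relations $=_{nf}$, $=_{hnf}$, $=_{whnf}$ on untyped $\lambda$-terms, the following problem is $\Pi^0_2$-complete: given $\lambda$-terms $M,N$, decide whether $M$ and $N$ are related.
   Context: Untyped $\lambda$-calculus with $\beta$-reduction; a context $C$ is a $\lambda$-term with one hole, $C[M]$ the result of filling it with $M$ (variable capture allowed). A head normal form (hnf) is a term $\lambda x_1\ldots\lambda x_n.\,y\,N_1\ldots N_m$ ($n,m\ge0$); a weak head normal form (whnf) is a term of the form $x\,M_1\ldots M_m$ or $\lambda x.M$; a term "has" a normal form (nf)/hnf/whnf if it $\beta$-reduces to one. Define $M=_{nf}N$ iff for all contexts $C$: $C[M]$ has a nf iff $C[N]$ has a nf; $M=_{hnf}N$ and $M=_{whnf}N$ are defined likewise with hnf and whnf. Terms are coded as natural numbers; $\Pi^0_2$-complete means every $\Pi^0_2$ set many-one reduces to the problem via a recursive function and the problem is itself (reducible to) a $\Pi^0_2$ set. *)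

theory Defs
  imports Main "HOL-Library.Nat_Bijection"
begin

section \<open>Untyped lambda terms and beta-reduction\<close>

text \<open>Terms modulo alpha-equivalence, in de Bruijn notation.  An index pointing beyond all
  enclosing binders is a free variable, so open terms are included.\<close>

datatype tm = Var nat | App tm tm | Lam tm

primrec lift :: "tm \<Rightarrow> nat \<Rightarrow> tm" where
  "lift (Var i) k = (if i < k then Var i else Var (Suc i))"
| "lift (App s t) k = App (lift s k) (lift t k)"
| "lift (Lam s) k = Lam (lift s (Suc k))"

text \<open>The term \<open>subst t s k\<close> is \<open>t\<close> with \<open>s\<close> for the variable \<open>k\<close>; since the binder of \<open>k\<close>
  disappears, the indices above \<open>k\<close> are decremented.\<close>

primrec subst :: "tm \<Rightarrow> tm \<Rightarrow> nat \<Rightarrow> tm" where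
  "subst (Var i) s k = (if k < i then Var (i - 1) else if i = k then s else Var i)"
| "subst (App t u) s k = App (subst t s k) (subst u s k)"
| "subst (Lam t) s k = Lam (subst t (lift s 0) (Suc k))"

inductive beta :: "tm \<Rightarrow> tm \<Rightarrow> bool" where
  redex: "beta (App (Lam s) t) (subst s t 0)"
| appL: "beta s s' \<Longrightarrow> beta (App s t) (App s' t)"
| appR: "beta t t' \<Longrightarrow> beta (App s t) (App s t')"
| lam: "beta s s' \<Longrightarrow> beta (Lam s) (Lam s')"


section \<open>Normal forms and observational equivalences\<close>

definition is_nf :: "tm \<Rightarrow> bool" where
  "is_nf t \<longleftrightarrow> \<not> (\<exists>u. beta t u)"

definition is_hnf :: "tm \<Rightarrow> bool" where
  "is_hnf t \<longleftrightarrow> (\<exists>n y Ns. t = (Lam ^^ n) (foldl App (Var y) Ns))"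

definition is_whnf :: "tm \<Rightarrow> bool" where
  "is_whnf t \<longleftrightarrow> (\<exists>x Ms. t = foldl App (Var x) Ms) \<or> (\<exists>u. t = Lam u)"

definition reduces_into :: "(tm \<Rightarrow> bool) \<Rightarrow> tm \<Rightarrow> bool" where
  "reduces_into P t \<longleftrightarrow> (\<exists>u. beta\<^sup>*\<^sup>* t u \<and> P u)"

datatype ctxt = Hole | AppL ctxt tm | AppR tm ctxt | LamC ctxt

text \<open>The hole is filled without shifting the indices of the term put into it: below \<open>k\<close>
  binders of the context, its free variables \<open>0, ..., k - 1\<close> are captured.\<close>

primrec fill :: "ctxt \<Rightarrow> tm \<Rightarrow> tm" where
  "fill Hole M = M"
| "fill (AppL C t) M = App (fill C M) t"
| "fill (AppR t C) M = App t (fill C M)"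
| "fill (LamC C) M = Lam (fill C M)"

definition obs_eq :: "(tm \<Rightarrow> bool) \<Rightarrow> tm \<Rightarrow> tm \<Rightarrow> bool" where
  "obs_eq P M N \<longleftrightarrow> (\<forall>C. reduces_into P (fill C M) \<longleftrightarrow> reduces_into P (fill C N))"

definition eq_nf :: "tm \<Rightarrow> tm \<Rightarrow> bool" where
  "eq_nf = obs_eq is_nf"

definition eq_hnf :: "tm \<Rightarrow> tm \<Rightarrow> bool" where
  "eq_hnf = obs_eq is_hnf"

definition eq_whnf :: "tm \<Rightarrow> tm \<Rightarrow> bool" where
  "eq_whnf = obs_eq is_whnf"


section \<open>Recursive functions and the class of \<open>\<Pi>\<^sup>0\<^sub>2\<close> sets\<close>

text \<open>The total recursive functions, following Kleene: minimization is applied only where it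
  yields a total function.  An \<open>n\<close>-ary function is a function on lists of which only
  the values at lists of length \<open>n\<close> are meaningful; the argument recursed on, respectively
  minimized over, comes first.\<close>

inductive recursive_fun :: "nat \<Rightarrow> (nat list \<Rightarrow> nat) \<Rightarrow> bool" where
  zero: "recursive_fun n (\<lambda>xs. 0)"
| succ: "recursive_fun 1 (\<lambda>xs. Suc (xs ! 0))"
| proj: "i < n \<Longrightarrow> recursive_fun n (\<lambda>xs. xs ! i)"
| comp: "recursive_fun (length gs) f \<Longrightarrow> (\<And>g. g \<in> set gs \<Longrightarrow> recursive_fun n g) \<Longrightarrow>
    recursive_fun n (\<lambda>xs. f (map (\<lambda>g. g xs) gs))"
| prim_rec: "recursive_fun n f \<Longrightarrow> recursive_fun (Suc (Suc n)) g \<Longrightarrow>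
    recursive_fun (Suc n)
      (\<lambda>xs. rec_nat (f (tl xs)) (\<lambda>k r. g (k # r # tl xs)) (hd xs))"
| minim: "recursive_fun (Suc n) f \<Longrightarrow>
    (\<And>xs. length xs = n \<Longrightarrow> \<exists>k. f (k # xs) = 0) \<Longrightarrow>
    recursive_fun n (\<lambda>xs. LEAST k. f (k # xs) = 0)"

definition pi02 :: "nat set \<Rightarrow> bool" where
  "pi02 A \<longleftrightarrow> (\<exists>R :: nat \<Rightarrow> nat \<Rightarrow> nat \<Rightarrow> bool.
     (\<exists>f. recursive_fun 3 f \<and> (\<forall>x y z. f [x, y, z] = (if R x y z then 1 else 0))) \<and>
     A = {x. \<forall>y. \<exists>z. R x y z})"

definition many_one_reducible :: "nat set \<Rightarrow> nat set \<Rightarrow> bool" where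
  "many_one_reducible A B \<longleftrightarrow>
     (\<exists>f. recursive_fun 1 f \<and> (\<forall>x. x \<in> A \<longleftrightarrow> f [x] \<in> B))"

definition pi02_complete :: "nat set \<Rightarrow> bool" where
  "pi02_complete A \<longleftrightarrow> pi02 A \<and> (\<forall>B. pi02 B \<longrightarrow> many_one_reducible B A)"


section \<open>Decision problems on pairs of terms\<close>

primrec term_code :: "tm \<Rightarrow> nat" where
  "term_code (Var i) = 3 * i"
| "term_code (App s t) = 3 * prod_encode (term_code s, term_code t) + 1"
| "term_code (Lam t) = 3 * term_code t + 2"

lemma bij_term_code: "bij term_code"
proof -
  have inj: "s = t" if "term_code s = term_code t" for s t
    using that
  proof (induction s arbitrary: t)
    case (Var i)
    then show ?case by (cases t) (auto, presburger+)
  next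
    case (App s1 s2)
    show ?case
    proof (cases t)
      case (App t1 t2)
      then have "prod_encode (term_code s1, term_code s2) = prod_encode (term_code t1, term_code t2)"
        using App.prems by simp
      then show ?thesis using App App.IH by simp
    qed (use App.prems in \<open>simp, presburger\<close>)+
  next
    case (Lam s)
    show ?case
    proof (cases t)
      case (Lam u)
      then show ?thesis using Lam.prems Lam.IH by simp
    qed (use Lam.prems in \<open>simp, presburger\<close>)+
  qed
  have surj: "\<exists>t. n = term_code t" for n
  proof (induction n rule: less_induct)
    case (less n)
    consider i where "n = 3 * i" | i where "n = 3 * i + 1" | i where "n = 3 * i + 2"
      by atomize_elim presburger
    then show ?case
    proof cases
      case (1 i)
      then have "n = term_code (Var i)" by simp
      then show ?thesis ..
    next
      case (2 i)
      obtain a b where i: "i = prod_encode (a, b)"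
        by (metis prod_decode_inverse surj_pair)
      have "a < n" "b < n"
        using 2 i le_prod_encode_1[of a b] le_prod_encode_2[of b a] by linarith+
      then obtain s t where "a = term_code s" "b = term_code t"
        using less.IH by blast
      then have "n = term_code (App s t)" using 2 i by simp
      then show ?thesis ..
    next
      case (3 i)
      then obtain s where "i = term_code s" using less.IH[of i] by auto
      then have "n = term_code (Lam s)" using 3 by simp
      then show ?thesis ..
    qed
  qed
  show ?thesis using inj surj unfolding bij_def inj_def surj_def by blast
qed

definition decision_problem :: "(tm \<Rightarrow> tm \<Rightarrow> bool) \<Rightarrow> nat set" where
  "decision_problem R = {prod_encode (term_code M, term_code N) | M N. R M N}"

end

theory Submission
  imports Defs
begin

text \<open>
  Hardness.  For a \<open>\<Pi>\<^sup>0\<^sub>2\<close> set \<open>{x. \<forall>k. \<exists>z. R x k z}\<close> let \<open>W\<^sub>k\<close> be a term which searches for some \<open>z\<close>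
  with \<open>R x k z\<close> and, after finding one, head reduces to \<open>\<lambda>v. v W\<^bsub>k+1\<^esub>\<close>; compare \<open>W\<^sub>0\<close> with a
  term \<open>N\<close> that head reduces to \<open>\<lambda>v. v N\<close>.  If all searches succeed, terms which differ only in
  having some \<open>W\<^sub>k\<close> in place of \<open>N\<close> simulate each other under weak head reduction, hence \<open>W\<^sub>0\<close> and
  \<open>N\<close> are equivalent in all three senses.  If \<open>k\<close> is the first search to fail, the context
  \<open>[] I \<dots> I (K I)\<close> with \<open>k\<close> arguments \<open>I\<close> separates them.  All the properties involved can be read
  off from weak head reduction by standardization, and the searches are programmed in
  continuation-passing style so that weak head reduction runs them.

  Membership.  ``\<open>C[M]\<close> reduces to a normal form'' is semidecidable, so that
  \<open>\<forall>C. C[M]\<close> has one \<open>\<longleftrightarrow>\<close> \<open>C[N]\<close> has one is \<open>\<Pi>\<^sup>0\<^sub>2\<close>.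
\<close>

section \<open>Syntax, standardization, and normal forms read off weak head reduction\<close>

section \<open>De Bruijn terms\<close>

lemma lift_lift: "i \<le> k \<Longrightarrow> lift (lift t i) (Suc k) = lift (lift t k) i"
  by (induction t arbitrary: i k) auto

lemma subst_lift_same [simp]: "subst (lift t k) s k = t"
  by (induction t arbitrary: k s) auto

lemma lift_subst:
  "k \<le> i \<Longrightarrow> lift (subst t s k) i = subst (lift t (Suc i)) (lift s i) k"
  by (induction t arbitrary: i k s) (auto simp: lift_lift)

lemma lift_subst_below:
  "i \<le> k \<Longrightarrow> lift (subst t s k) i = subst (lift t i) (lift s i) (Suc k)"
  by (induction t arbitrary: i k s) (auto simp: lift_lift)

lemma subst_subst:
  "i \<le> k \<Longrightarrow> subst (subst t s i) r k = subst (subst t (lift r i) (Suc k)) (subst s r k) i"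
  by (induction t arbitrary: i k s r) (auto simp: lift_lift [symmetric] lift_subst_below)

text \<open>Stated as invariance under \<open>lift\<close> and \<open>subst\<close>: with these two
  facts the simplifier can run programs around subterms of which nothing but closedness is
  known.\<close>

definition closed :: "tm \<Rightarrow> bool" where
  "closed t \<longleftrightarrow> (\<forall>k. lift t k = t) \<and> (\<forall>s k. subst t s k = t)"

lemma closedI: "(\<And>k. lift t k = t) \<Longrightarrow> (\<And>s k. subst t s k = t) \<Longrightarrow> closed t"
  by (simp add: closed_def)

lemma closed_lift [simp]: "closed t \<Longrightarrow> lift t k = t"
  and closed_subst [simp]: "closed t \<Longrightarrow> subst t s k = t"
  by (simp_all add: closed_def)

lemma closed_App [simp]: "closed s \<Longrightarrow> closed t \<Longrightarrow> closed (App s t)"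
  by (rule closedI) simp_all

section \<open>Weak head reduction and standardization\<close>

inductive wh :: "tm \<Rightarrow> tm \<Rightarrow> bool" where
  redex: "wh (App (Lam s) t) (subst s t 0)"
| appL: "wh s s' \<Longrightarrow> wh (App s t) (App s' t)"

inductive_cases wh_VarE [elim!]: "wh (Var i) u"
inductive_cases wh_LamE [elim!]: "wh (Lam s) u"
inductive_cases wh_AppE: "wh (App s t) u"

lemma wh_deterministic: "wh s t \<Longrightarrow> wh s u \<Longrightarrow> t = u"
proof (induction arbitrary: u rule: wh.induct)
  case (redex s t)
  then show ?case by cases auto
next
  case (appL s s' t)
  from appL.prems show ?case using appL.hyps appL.IH by cases blast+
qed

lemma wh_beta: "wh s t \<Longrightarrow> beta s t"
  by (induction rule: wh.induct) (auto intro: beta.intros)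

lemma whs_betas: "wh\<^sup>*\<^sup>* s t \<Longrightarrow> beta\<^sup>*\<^sup>* s t"
  by (metis (mono_tags, lifting) wh_beta rtranclp_mono predicate2I predicate2D)

lemma whs_App: "wh\<^sup>*\<^sup>* s s' \<Longrightarrow> wh\<^sup>*\<^sup>* (App s t) (App s' t)"
  by (induction rule: rtranclp_induct) (auto intro: wh.appL rtranclp.rtrancl_into_rtrancl)

lemma whp_App: "wh\<^sup>+\<^sup>+ s s' \<Longrightarrow> wh\<^sup>+\<^sup>+ (App s t) (App s' t)"
  by (induction rule: tranclp_induct) (auto intro: wh.appL tranclp.trancl_into_trancl)

lemma wh_lift: "wh s t \<Longrightarrow> wh (lift s k) (lift t k)"
  by (induction rule: wh.induct) (auto simp: lift_subst intro: wh.intros)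

lemma wh_subst: "wh s t \<Longrightarrow> wh (subst s r k) (subst t r k)"
  by (induction rule: wh.induct) (auto simp: subst_subst intro: wh.intros)

lemma whs_lift: "wh\<^sup>*\<^sup>* s t \<Longrightarrow> wh\<^sup>*\<^sup>* (lift s k) (lift t k)"
  by (induction rule: rtranclp_induct) (auto intro: wh_lift rtranclp.rtrancl_into_rtrancl)

lemma whs_subst: "wh\<^sup>*\<^sup>* s t \<Longrightarrow> wh\<^sup>*\<^sup>* (subst s r k) (subst t r k)"
  by (induction rule: rtranclp_induct) (auto intro: wh_subst rtranclp.rtrancl_into_rtrancl)

text \<open>Standard reduction in the style of Loader and Kashima.\<close>

inductive std :: "tm \<Rightarrow> tm \<Rightarrow> bool" where
  std_Var: "wh\<^sup>*\<^sup>* t (Var i) \<Longrightarrow> std t (Var i)"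
| std_App: "wh\<^sup>*\<^sup>* t (App a b) \<Longrightarrow> std a a' \<Longrightarrow> std b b' \<Longrightarrow> std t (App a' b')"
| std_Lam: "wh\<^sup>*\<^sup>* t (Lam a) \<Longrightarrow> std a a' \<Longrightarrow> std t (Lam a')"

inductive_cases std_VarE: "std t (Var i)"
inductive_cases std_AppE: "std t (App a b)"
inductive_cases std_LamE: "std t (Lam a)"

lemma std_refl: "std t t"
  by (induction t) (auto intro: std.intros)

lemma whs_std: "wh\<^sup>*\<^sup>* t t' \<Longrightarrow> std t' u \<Longrightarrow> std t u"
  by (erule std.cases) (auto intro: std.intros rtranclp_trans)

lemma std_lift: "std t u \<Longrightarrow> std (lift t k) (lift u k)"
proof (induction arbitrary: k rule: std.induct)
  case (std_Var t i)
  then show ?case using whs_lift [of t "Var i" k] by (auto intro: std.intros)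
next
  case (std_App t a b a' b')
  then show ?case using whs_lift [of t "App a b" k] by (auto intro: std.intros)
next
  case (std_Lam t a a')
  then show ?case using whs_lift [of t "Lam a" k] by (auto intro: std.intros)
qed

lemma std_subst: "std t u \<Longrightarrow> std s s' \<Longrightarrow> std (subst t s k) (subst u s' k)"
proof (induction arbitrary: s s' k rule: std.induct)
  case (std_Var t i)
  have "std (subst (Var i) s k) (subst (Var i) s' k)"
    using std_Var.prems by (auto intro: std_refl)
  then show ?case using whs_subst [OF std_Var.hyps] by (blast intro: whs_std)
next
  case (std_App t a b a' b')
  then show ?case using whs_subst [of t "App a b" s k] by (auto intro: std.intros)
next
  case (std_Lam t a a')
  then show ?case using whs_subst [of t "Lam a" s k] by (auto intro: std.std_Lam std_lift std_Lam.IH)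
qed

text \<open>A beta step is absorbed at the end of a standard reduction: inverting \<open>std\<close>
  twice at the contracted redex exposes a weak head redex reached from \<open>t\<close>; contracting
  it extends the weak head reduction, and \<open>std_subst\<close> handles the rest.\<close>

lemma std_beta: "beta u v \<Longrightarrow> std t u \<Longrightarrow> std t v"
proof (induction arbitrary: t rule: beta.induct)
  case (redex s r)
  then obtain a b where ab: "wh\<^sup>*\<^sup>* t (App a b)" "std a (Lam s)" "std b r"
    by (auto elim: std_AppE)
  then obtain a0 where a0: "wh\<^sup>*\<^sup>* a (Lam a0)" "std a0 s" by (auto elim: std_LamE)
  have "wh\<^sup>*\<^sup>* t (App (Lam a0) b)" using ab(1) whs_App [OF a0(1)] by (rule rtranclp_trans)
  then have "wh\<^sup>*\<^sup>* t (subst a0 b 0)" by (blast intro: wh.redex rtranclp.rtrancl_into_rtrancl)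
  then show ?case using std_subst [OF a0(2) ab(3)] by (rule whs_std)
qed (auto elim!: std_AppE std_LamE intro: std.intros)

theorem standardization: "beta\<^sup>*\<^sup>* t u \<Longrightarrow> std t u"
  by (induction rule: rtranclp_induct) (auto intro: std_refl std_beta)

section \<open>Having a normal form, through weak head reduction\<close>

abbreviation neutral :: "nat \<Rightarrow> tm list \<Rightarrow> tm" where
  "neutral x Ms \<equiv> foldl App (Var x) Ms"

lemma Lam_neq_neutral [simp]: "Lam t \<noteq> neutral x Ms"
  by (cases Ms rule: rev_cases) auto

lemmas neutral_neq_Lam [simp] = Lam_neq_neutral [symmetric]

lemma is_whnf_Lam [simp]: "is_whnf (Lam t)"
  and is_whnf_neutral [simp]: "is_whnf (neutral x Ms)"
  by (auto simp: is_whnf_def)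

lemma neutral_eq: "neutral x Ms = neutral y Ns \<Longrightarrow> Ms = Ns"
proof (induction Ms arbitrary: Ns rule: rev_induct)
  case Nil
  then show ?case by (cases Ns rule: rev_cases) auto
next
  case (snoc M Ms)
  then show ?case by (cases Ns rule: rev_cases) auto
qed

lemma neutral_not_wh: "\<not> wh (neutral x Ms) u"
proof (induction Ms arbitrary: u rule: rev_induct)
  case (snoc M Ms)
  show ?case
  proof
    assume "wh (neutral x (Ms @ [M])) u"
    then have "wh (App (neutral x Ms) M) u" by simp
    then show False
    proof cases
      case (redex s)
      then show ?thesis by (metis Lam_neq_neutral)
    next
      case (appL s')
      then show ?thesis using snoc.IH by blast
    qed
  qed
qed auto

lemma whnf_not_wh: "is_whnf t \<Longrightarrow> \<not> wh t u"
  by (auto simp: is_whnf_def neutral_not_wh)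

text \<open>By determinism the reduction from \<open>s\<close> to the weak head normal form
  \<open>u\<close> passes through \<open>t\<close>. The strict decrease \<open>k < n\<close> is the
  measure both for simulations and for the divergence of failing searches.\<close>

lemma whnf_progress:
  assumes "(wh ^^ n) s u" "is_whnf u" "wh\<^sup>+\<^sup>+ s t"
  obtains k where "k < n" "(wh ^^ k) t u"
proof -
  from assms(3) obtain m where "0 < m" "(wh ^^ m) s t" by (auto simp: tranclp_power)
  with assms(1) have "\<exists>k<n. (wh ^^ k) t u"
  proof (induction m arbitrary: s n)
    case (Suc m)
    from Suc.prems(3) obtain s1 where s1: "wh s s1" "(wh ^^ m) s1 t" by (meson relpowp_Suc_D2)
    show ?case
    proof (cases n)
      case 0
      with Suc.prems s1 assms(2) show ?thesis by (auto dest: whnf_not_wh)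
    next
      case n: (Suc n')
      with Suc.prems(1) s1 have n': "(wh ^^ n') s1 u"
        by (metis relpowp_Suc_D2 wh_deterministic)
      show ?thesis
      proof (cases m)
        case 0
        with s1 n' n show ?thesis by auto
      next
        case (Suc _)
        with Suc.IH [OF n' _ s1(2)] n show ?thesis by (auto intro: less_SucI)
      qed
    qed
  qed auto
  with that show ?thesis by blast
qed

lemma std_neutral:
  "std t (neutral x Us) \<Longrightarrow> \<exists>Ms. wh\<^sup>*\<^sup>* t (neutral x Ms) \<and> list_all2 std Ms Us"
proof (induction Us arbitrary: t rule: rev_induct)
  case Nil
  then show ?case by (auto elim!: std_VarE intro: exI [of _ "[]"])
next
  case (snoc U Us)
  then obtain a b where ab: "wh\<^sup>*\<^sup>* t (App a b)" "std a (neutral x Us)" "std b U"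
    by (auto elim: std_AppE)
  with snoc obtain Ms where "wh\<^sup>*\<^sup>* a (neutral x Ms)" "list_all2 std Ms Us" by blast
  with ab have "wh\<^sup>*\<^sup>* t (neutral x (Ms @ [b]))" "list_all2 std (Ms @ [b]) (Us @ [U])"
    by (auto intro: whs_App rtranclp_trans list_all2_appendI)
  then show ?case by blast
qed

text \<open>The weak head steps at the start of a standard reduction already reach the outer shape
  of its target, so they suffice to reach a weak head normal form.\<close>

lemma reduces_into_whnf_iff: "reduces_into is_whnf t \<longleftrightarrow> (\<exists>u. wh\<^sup>*\<^sup>* t u \<and> is_whnf u)"
proof
  assume "reduces_into is_whnf t"
  then obtain u where "beta\<^sup>*\<^sup>* t u" and u: "is_whnf u" by (auto simp: reduces_into_def)
  then have "std t u" by (simp add: standardization)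
  with u show "\<exists>u. wh\<^sup>*\<^sup>* t u \<and> is_whnf u"
    unfolding is_whnf_def by (metis std_neutral std_LamE)
qed (auto simp: reduces_into_def intro: whs_betas)

text \<open>Head reduction split into weak head phases, with one descent under an abstraction after
  each. This gives an induction in which \<open>sim_whnf\<close> handles a single phase.\<close>

inductive has_hnf :: "tm \<Rightarrow> bool" where
  hnf_neutral: "wh\<^sup>*\<^sup>* t (neutral x Ms) \<Longrightarrow> has_hnf t"
| hnf_Lam: "wh\<^sup>*\<^sup>* t (Lam u) \<Longrightarrow> has_hnf u \<Longrightarrow> has_hnf t"

text \<open>Says that the Boehm tree of \<open>t\<close> is finite and has no undefined node, the
  tree being explored by weak head reduction.\<close>

inductive has_nf :: "tm \<Rightarrow> bool" where
  nf_neutral: "wh\<^sup>*\<^sup>* t (neutral x Ms) \<Longrightarrow> (\<And>M. M \<in> set Ms \<Longrightarrow> has_nf M) \<Longrightarrow> has_nf t"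
| nf_Lam: "wh\<^sup>*\<^sup>* t (Lam u) \<Longrightarrow> has_nf u \<Longrightarrow> has_nf t"

lemma betas_Lam: "beta\<^sup>*\<^sup>* s s' \<Longrightarrow> beta\<^sup>*\<^sup>* (Lam s) (Lam s')"
  by (induction rule: rtranclp_induct) (auto intro: beta.lam rtranclp.rtrancl_into_rtrancl)

lemma betas_App: "beta\<^sup>*\<^sup>* s s' \<Longrightarrow> beta\<^sup>*\<^sup>* t t' \<Longrightarrow> beta\<^sup>*\<^sup>* (App s t) (App s' t')"
proof -
  assume "beta\<^sup>*\<^sup>* s s'" and t: "beta\<^sup>*\<^sup>* t t'"
  then have "beta\<^sup>*\<^sup>* (App s t) (App s' t)"
    by (induction rule: rtranclp_induct) (auto intro: beta.appL rtranclp.rtrancl_into_rtrancl)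
  also from t have "beta\<^sup>*\<^sup>* (App s' t) (App s' t')"
    by (induction rule: rtranclp_induct) (auto intro: beta.appR rtranclp.rtrancl_into_rtrancl)
  finally show ?thesis .
qed

lemma reduces_into_hnf_iff: "reduces_into is_hnf t \<longleftrightarrow> has_hnf t"
proof
  assume "reduces_into is_hnf t"
  then obtain n y Ns where "beta\<^sup>*\<^sup>* t ((Lam ^^ n) (neutral y Ns))"
    by (auto simp: reduces_into_def is_hnf_def)
  then have "std t ((Lam ^^ n) (neutral y Ns))" by (rule standardization)
  then show "has_hnf t"
  proof (induction n arbitrary: t)
    case 0
    then show ?case by (auto dest: std_neutral intro: hnf_neutral)
  next
    case (Suc n)
    then show ?case by (auto elim!: std_LamE intro: hnf_Lam)
  qed
next
  assume "has_hnf t"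
  then show "reduces_into is_hnf t"
  proof induction
    case (hnf_neutral t x Ms)
    moreover have "is_hnf (neutral x Ms)"
      unfolding is_hnf_def by (rule exI [of _ 0]) auto
    ultimately show ?case by (auto simp: reduces_into_def dest: whs_betas)
  next
    case (hnf_Lam t u)
    then obtain n y Ns where "beta\<^sup>*\<^sup>* u ((Lam ^^ n) (neutral y Ns))"
      by (auto simp: reduces_into_def is_hnf_def)
    then have "beta\<^sup>*\<^sup>* t ((Lam ^^ Suc n) (neutral y Ns))"
      using whs_betas [OF hnf_Lam.hyps(1)] by (auto intro: rtranclp_trans betas_Lam)
    then show ?case unfolding reduces_into_def is_hnf_def by blast
  qed
qed

lemma is_nf_simps [simp]:
  "is_nf (Var x)" "is_nf (Lam t) \<longleftrightarrow> is_nf t"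
  "is_nf (App s t) \<longleftrightarrow> is_nf s \<and> is_nf t \<and> (\<forall>u. s \<noteq> Lam u)"
  by (auto simp: is_nf_def elim: beta.cases intro: beta.intros)

lemma is_nf_neutral [simp]: "is_nf (neutral x Ms) \<longleftrightarrow> (\<forall>M\<in>set Ms. is_nf M)"
proof (induction Ms rule: rev_induct)
  case (snoc M Ms)
  then show ?case by (cases Ms rule: rev_cases) auto
qed auto

lemma nf_cases:
  assumes "is_nf t"
  obtains u where "t = Lam u" | x Ms where "t = neutral x Ms"
proof -
  from assms have "(\<exists>u. t = Lam u) \<or> (\<exists>x Ms. t = neutral x Ms)"
  proof (induction t)
    case (Var x)
    then show ?case by (metis foldl_Nil)
  next
    case (App s t)
    then obtain x Ms where "s = neutral x Ms" by auto
    then have "App s t = neutral x (Ms @ [t])" by simp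
    then show ?case by blast
  qed auto
  then show ?thesis using that by blast
qed

lemma size_neutral: "M \<in> set Ms \<Longrightarrow> size M < size (neutral x Ms)"
  by (induction Ms rule: rev_induct) auto

text \<open>The induction is on the size of \<open>u\<close>, not on \<open>std\<close>: for a
  neutral \<open>u\<close>, \<open>std_neutral\<close> yields all arguments at once, and each of
  them is smaller than \<open>u\<close>.\<close>

lemma std_nf_has_nf: "std t u \<Longrightarrow> is_nf u \<Longrightarrow> has_nf t"
proof (induction "size u" arbitrary: t u rule: less_induct)
  case less
  from less.prems(2) show ?case
  proof (cases rule: nf_cases)
    case (1 v)
    with less show ?thesis by (auto elim!: std_LamE intro: nf_Lam)
  next
    case (2 x Us)
    with less.prems obtain Ms where Ms: "wh\<^sup>*\<^sup>* t (neutral x Ms)" "list_all2 std Ms Us"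
      by (auto dest: std_neutral)
    have "has_nf M" if M: "M \<in> set Ms" for M
    proof -
      from M Ms(2) obtain U where U: "U \<in> set Us" "std M U"
        by (metis list_all2_conv_all_nth in_set_conv_nth)
      with 2 less.prems(2) have "size U < size u" "is_nf U" by (auto intro: size_neutral)
      with U(2) less.hyps show ?thesis by blast
    qed
    with Ms(1) show ?thesis by (rule nf_neutral)
  qed
qed

lemma reduces_into_nf_iff: "reduces_into is_nf t \<longleftrightarrow> has_nf t"
proof
  assume "reduces_into is_nf t"
  then show "has_nf t"
    by (auto simp: reduces_into_def intro: std_nf_has_nf standardization)
next
  assume "has_nf t"
  then show "reduces_into is_nf t"
  proof induction
    case (nf_neutral t x Ms)
    have "\<exists>Us. beta\<^sup>*\<^sup>* (neutral x Ms) (neutral x Us) \<and> (\<forall>U\<in>set Us. is_nf U)"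
      using nf_neutral.IH
    proof (induction Ms rule: rev_induct)
      case Nil
      then show ?case by (intro exI [of _ "[]"]) auto
    next
      case (snoc M Ms)
      then obtain Us where "beta\<^sup>*\<^sup>* (neutral x Ms) (neutral x Us)" "\<forall>U\<in>set Us. is_nf U"
        by fastforce
      moreover obtain U where "beta\<^sup>*\<^sup>* M U" "is_nf U"
        using snoc.prems [of M] by (auto simp: reduces_into_def)
      ultimately show ?case by (intro exI [of _ "Us @ [U]"]) (auto intro: betas_App)
    qed
    with nf_neutral.hyps(1) show ?case
      unfolding reduces_into_def using is_nf_neutral by (meson whs_betas rtranclp_trans)
  next
    case (nf_Lam t u)
    then obtain v where "beta\<^sup>*\<^sup>* u v" "is_nf v" by (auto simp: reduces_into_def)
    then have "beta\<^sup>*\<^sup>* t (Lam v)" "is_nf (Lam v)"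
      using whs_betas [OF nf_Lam.hyps(1)] by (auto intro: rtranclp_trans betas_Lam)
    then show ?case unfolding reduces_into_def by blast
  qed
qed

section \<open>Tools for hardness: simulations, programs, and streams guarded by searches\<close>

section \<open>Simulation\<close>

text \<open>Meant for relations \<open>B\<close> between closed terms: \<open>s\<close> and \<open>t\<close> arise from a common context with
  several holes by filling in related terms.\<close>

inductive sim :: "(tm \<Rightarrow> tm \<Rightarrow> bool) \<Rightarrow> tm \<Rightarrow> tm \<Rightarrow> bool" for B where
  sim_base: "B a b \<Longrightarrow> sim B a b"
| sim_Var: "sim B (Var x) (Var x)"
| sim_App: "sim B s s' \<Longrightarrow> sim B t t' \<Longrightarrow> sim B (App s t) (App s' t')"
| sim_Lam: "sim B s s' \<Longrightarrow> sim B (Lam s) (Lam s')"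

lemma sim_refl: "sim B t t"
  by (induction t) (auto intro: sim.intros)

lemma sim_fill: "B a b \<Longrightarrow> sim B (fill C a) (fill C b)"
  by (induction C) (auto intro: sim.intros sim_refl)

text \<open>The left side must make at least one step while the right side may make any number, so
  that each round shortens the reduction of the left term to its weak head normal form. One
  simulation yields one implication of observational equivalence.\<close>

definition simulation :: "(tm \<Rightarrow> tm \<Rightarrow> bool) \<Rightarrow> bool" where
  "simulation B \<longleftrightarrow> (\<forall>a b. B a b \<longrightarrow> closed a \<and> closed b \<and>
     (\<exists>a' b'. wh\<^sup>+\<^sup>+ a (Lam a') \<and> wh\<^sup>*\<^sup>* b (Lam b') \<and> sim B a' b'))"

context
  fixes B
  assumes B: "simulation B"
begin

lemma sim_lift: "sim B s t \<Longrightarrow> sim B (lift s k) (lift t k)"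
proof (induction arbitrary: k rule: sim.induct)
  case (sim_base a b)
  with B have "closed a" "closed b" by (auto simp: simulation_def)
  with sim_base show ?case by (simp add: sim.sim_base)
qed (auto intro: sim.intros)

lemma sim_subst: "sim B s t \<Longrightarrow> sim B r r' \<Longrightarrow> sim B (subst s r k) (subst t r' k)"
proof (induction arbitrary: r r' k rule: sim.induct)
  case (sim_base a b)
  with B have "closed a" "closed b" by (auto simp: simulation_def)
  with sim_base show ?case by (simp add: sim.sim_base)
next
  case (sim_Lam s s')
  then show ?case by (simp add: sim.sim_Lam sim_lift)
qed (auto intro: sim.intros)

text \<open>Induction on the common context. The case that matters is an application of related
  abstractions: both sides are redexes, the left contraction is the required step, and
  \<open>sim_subst\<close> relates the results.\<close>

lemma sim_progress:
  assumes "sim B s t"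
  obtains (Lam) u v where "s = Lam u" "t = Lam v" "sim B u v"
  | (neutral) x Ms Ns where "s = neutral x Ms" "t = neutral x Ns" "list_all2 (sim B) Ms Ns"
  | (step) s' t' where "wh\<^sup>+\<^sup>+ s s'" "wh\<^sup>*\<^sup>* t t'" "sim B s' t'"
proof -
  from assms have "(\<exists>u v. s = Lam u \<and> t = Lam v \<and> sim B u v) \<or>
    (\<exists>x Ms Ns. s = neutral x Ms \<and> t = neutral x Ns \<and> list_all2 (sim B) Ms Ns) \<or>
    (\<exists>s' t'. wh\<^sup>+\<^sup>+ s s' \<and> wh\<^sup>*\<^sup>* t t' \<and> sim B s' t')"
  proof (induction rule: sim.induct)
    case (sim_base a b)
    then show ?case using B unfolding simulation_def by (meson sim_Lam)
  next
    case (sim_Var x)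
    have "Var x = neutral x []" by simp
    then show ?case by (metis list_all2_Nil)
  next
    case (sim_App s s' t t')
    from sim_App.IH(1) consider
      (L) u v where "s = Lam u" "s' = Lam v" "sim B u v"
    | (N) x Ms Ns where "s = neutral x Ms" "s' = neutral x Ns" "list_all2 (sim B) Ms Ns"
    | (S) r r' where "wh\<^sup>+\<^sup>+ s r" "wh\<^sup>*\<^sup>* s' r'" "sim B r r'" by blast
    then show ?case
    proof cases
      case (L u v)
      then have "wh\<^sup>+\<^sup>+ (App s t) (subst u t 0)" "wh\<^sup>*\<^sup>* (App s' t') (subst v t' 0)"
        by (auto intro: wh.redex)
      moreover have "sim B (subst u t 0) (subst v t' 0)"
        using L sim_App.hyps(2) by (intro sim_subst)
      ultimately show ?thesis by blast
    next
      case (N x Ms Ns)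
      then have "App s t = neutral x (Ms @ [t])" "App s' t' = neutral x (Ns @ [t'])"
        "list_all2 (sim B) (Ms @ [t]) (Ns @ [t'])"
        using sim_App.hyps(2) by (auto intro: list_all2_appendI)
      then show ?thesis by blast
    next
      case (S r r')
      then show ?thesis using sim_App.hyps(2) by (meson whp_App whs_App sim.sim_App)
    qed
  qed auto
  then show ?thesis using that by blast
qed

text \<open>Induction on the length of the left reduction, which \<open>whnf_progress\<close>
  shortens whenever \<open>sim_progress\<close> ends in the case \<open>step\<close>.\<close>

lemma sim_whnf:
  assumes "wh\<^sup>*\<^sup>* s u" "is_whnf u" "sim B s t"
  obtains (Lam) v v' where "u = Lam v" "wh\<^sup>*\<^sup>* t (Lam v')" "sim B v v'"
  | (neutral) x Ms Ns where "u = neutral x Ms" "wh\<^sup>*\<^sup>* t (neutral x Ns)" "list_all2 (sim B) Ms Ns"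
proof -
  from assms(1) obtain n where "(wh ^^ n) s u" by (auto simp: rtranclp_power)
  from this assms(3) have "(\<exists>v v'. u = Lam v \<and> wh\<^sup>*\<^sup>* t (Lam v') \<and> sim B v v') \<or>
    (\<exists>x Ms Ns. u = neutral x Ms \<and> wh\<^sup>*\<^sup>* t (neutral x Ns) \<and> list_all2 (sim B) Ms Ns)"
  proof (induction n arbitrary: s t rule: less_induct)
    case (less n)
    from less.prems have su: "wh\<^sup>*\<^sup>* s u" by (meson rtranclp_power)
    from less.prems(2) show ?case
    proof (cases rule: sim_progress)
      case (Lam v v')
      with su have "u = Lam v" by (auto elim: converse_rtranclpE)
      with Lam show ?thesis by blast
    next
      case (neutral x Ms Ns)
      with su have "u = neutral x Ms" by (metis converse_rtranclpE neutral_not_wh)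
      with neutral show ?thesis by blast
    next
      case (step s' t')
      then obtain k where "k < n" "(wh ^^ k) s' u"
        using less.prems(1) assms(2) whnf_progress by blast
      with less.IH step(3) have "(\<exists>v v'. u = Lam v \<and> wh\<^sup>*\<^sup>* t' (Lam v') \<and> sim B v v') \<or>
        (\<exists>x Ms Ns. u = neutral x Ms \<and> wh\<^sup>*\<^sup>* t' (neutral x Ns) \<and> list_all2 (sim B) Ms Ns)"
        by blast
      moreover have "wh\<^sup>*\<^sup>* t v" if "wh\<^sup>*\<^sup>* t' v" for v
        using step(2) that by (rule rtranclp_trans)
      ultimately show ?thesis by blast
    qed
  qed
  with that show ?thesis by blast
qed

lemma sim_reduces_into_whnf: "reduces_into is_whnf s \<Longrightarrow> sim B s t \<Longrightarrow> reduces_into is_whnf t"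
  unfolding reduces_into_whnf_iff by (metis sim_whnf is_whnf_Lam is_whnf_neutral)

lemma sim_reduces_into_hnf: "reduces_into is_hnf s \<Longrightarrow> sim B s t \<Longrightarrow> reduces_into is_hnf t"
  unfolding reduces_into_hnf_iff
proof (induction arbitrary: t rule: has_hnf.induct)
  case (hnf_neutral s x Ms)
  from this(1) is_whnf_neutral this(2) show ?case
    by (cases rule: sim_whnf) (auto intro: has_hnf.intros)
next
  case (hnf_Lam s u)
  from this(1) is_whnf_Lam this(4) show ?case
    using hnf_Lam.IH by (cases rule: sim_whnf) (auto intro: has_hnf.intros)
qed

lemma sim_reduces_into_nf: "reduces_into is_nf s \<Longrightarrow> sim B s t \<Longrightarrow> reduces_into is_nf t"
  unfolding reduces_into_nf_iff
proof (induction arbitrary: t rule: has_nf.induct)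
  case (nf_neutral s x Ms)
  from this(1) is_whnf_neutral this(4) show ?case
  proof (cases rule: sim_whnf)
    case (neutral y Ms' Ns)
    then have "list_all2 (sim B) Ms Ns" by (auto dest: neutral_eq)
    then have "has_nf N" if "N \<in> set Ns" for N
      using that nf_neutral.IH by (metis in_set_conv_nth list_all2_conv_all_nth)
    with neutral show ?thesis by (auto intro: has_nf.intros)
  qed auto
next
  case (nf_Lam s u)
  from this(1) is_whnf_Lam this(4) show ?case
    using nf_Lam.IH by (cases rule: sim_whnf) (auto intro: has_nf.intros)
qed

end


section \<open>Recursive functions as closed terms in continuation-passing style\<close>

text \<open>Scott numerals and Scott lists: under weak head reduction a numeral or a list selects a
  branch without evaluating anything else.\<close>

primrec num :: "nat \<Rightarrow> tm" where
  "num 0 = Lam (Lam (Var 1))"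
| "num (Suc n) = Lam (Lam (App (Var 0) (num n)))"

primrec enc :: "nat list \<Rightarrow> tm" where
  "enc [] = Lam (Lam (Var 1))"
| "enc (x # xs) = Lam (Lam (App (App (Var 0) (num x)) (enc xs)))"

lemma closed_num [simp]: "closed (num n)"
  by (induction n) (auto intro: closedI)

lemma closed_enc [simp]: "closed (enc xs)"
  by (induction xs) (auto intro: closedI)

text \<open>An executable form of \<open>wh\<close>, constant on weak head normal forms, by which
  the simplifier runs programs for a stated number of steps.\<close>

fun step :: "tm \<Rightarrow> tm" where
  "step (App (Lam s) t) = subst s t 0"
| "step (App s t) = App (step s) t"
| "step t = t"

lemma whs_step: "wh\<^sup>*\<^sup>* t (step t)"
  by (induction t rule: step.induct) (auto intro: wh.redex whs_App)

lemma whs_steps: "(step ^^ n) t = u \<Longrightarrow> wh\<^sup>*\<^sup>* t u"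
  by (induction n arbitrary: u) (auto intro: whs_step rtranclp_trans)

text \<open>The continuation receives the finished numeral \<open>num (f xs)\<close>, so that weak
  head reduction, which never works inside arguments, evaluates nested programs as well. As
  \<open>K\<close> is closed, substitutions leave it alone.\<close>

definition computes :: "tm \<Rightarrow> nat \<Rightarrow> (nat list \<Rightarrow> nat) \<Rightarrow> bool" where
  "computes F n f \<longleftrightarrow> closed F \<and> (\<forall>xs K. length xs = n \<longrightarrow> closed K \<longrightarrow>
     wh\<^sup>*\<^sup>* (App (App F (enc xs)) K) (App K (num (f xs))))"

lemma computesI:
  assumes "closed F"
    and "\<And>xs K. length xs = n \<Longrightarrow> closed K \<Longrightarrow> wh\<^sup>*\<^sup>* (App (App F (enc xs)) K) (App K (num (f xs)))"
  shows "computes F n f"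
  using assms by (simp add: computes_def)

lemma computes_closed: "computes F n f \<Longrightarrow> closed F"
  by (simp add: computes_def)

lemma computesD:
  "computes F n f \<Longrightarrow> length xs = n \<Longrightarrow> closed K \<Longrightarrow>
   wh\<^sup>*\<^sup>* (App (App F (enc xs)) K) (App K (num (f xs)))"
  by (simp add: computes_def)

section \<open>Programs for the generating schemes of recursive functions\<close>

lemma computes_zero: "\<exists>F. computes F n (\<lambda>xs. 0)"
proof
  show "computes (Lam (Lam (App (Var 0) (num 0)))) n (\<lambda>xs. 0)"
    by (rule computesI, rule closedI)
      (auto intro!: whs_steps [of 2] simp: eval_nat_numeral simp del: num.simps)
qed

lemma computes_succ: "\<exists>F. computes F 1 (\<lambda>xs. Suc (xs ! 0))"
proof
  \<comment> \<open>In named form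
    \<open>\<lambda>xs k. xs xs (\<lambda>y ys. k (\<lambda>a b. b y))\<close>. The list itself
    serves as a dummy branch for the empty list; that branch is never selected.\<close>
  let ?F = "Lam (Lam (App (App (Var 1) (Var 1))
    (Lam (Lam (App (Var 2) (Lam (Lam (App (Var 0) (Var 3)))))))))"
  show "computes ?F 1 (\<lambda>xs. Suc (xs ! 0))"
  proof (rule computesI)
    fix xs :: "nat list" and K
    assume "length xs = 1" "closed K"
    then show "wh\<^sup>*\<^sup>* (App (App ?F (enc xs)) K) (App K (num (Suc (xs ! 0))))"
      by (intro whs_steps [of 6]) (auto simp: eval_nat_numeral length_Suc_conv)
  qed (auto intro: closedI)
qed

primrec proj_tm :: "nat \<Rightarrow> tm" where
  "proj_tm 0 = Lam (Lam (App (App (Var 1) (Var 1)) (Lam (Lam (App (Var 2) (Var 1))))))"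
| "proj_tm (Suc i) =
    Lam (Lam (App (App (Var 1) (Var 1)) (Lam (Lam (App (App (proj_tm i) (Var 0)) (Var 2))))))"

lemma closed_proj_tm [simp]: "closed (proj_tm i)"
  by (induction i) (auto intro: closedI)

lemma proj_tm:
  "i < length xs \<Longrightarrow> closed K \<Longrightarrow> wh\<^sup>*\<^sup>* (App (App (proj_tm i) (enc xs)) K) (App K (num (xs ! i)))"
proof (induction i arbitrary: xs)
  case 0
  then obtain y ys where "xs = y # ys" by (cases xs) auto
  with 0 show ?case by (intro whs_steps [of 6]) (simp add: eval_nat_numeral)
next
  case (Suc i)
  then obtain y ys where xs: "xs = y # ys" by (cases xs) auto
  have "wh\<^sup>*\<^sup>* (App (App (proj_tm (Suc i)) (enc xs)) K) (App (App (proj_tm i) (enc ys)) K)"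
    using Suc.prems xs by (intro whs_steps [of 6]) (simp add: eval_nat_numeral)
  with Suc xs show ?case by (auto intro: rtranclp_trans)
qed

text \<open>Evaluates the inner functions of a composition one after the other. With
  \<open>T\<close> for the tuple program of the tail, the second clause is \<open>\<lambda>xs k. G
  xs (\<lambda>r. T xs (\<lambda>rs. k (r # rs)))\<close>.\<close>

primrec tuple_tm :: "tm list \<Rightarrow> tm" where
  "tuple_tm [] = Lam (Lam (App (Var 0) (enc [])))"
| "tuple_tm (G # Gs) =
    Lam (Lam (App (App G (Var 1)) (Lam (App (App (tuple_tm Gs) (Var 2))
      (Lam (App (Var 2) (Lam (Lam (App (App (Var 0) (Var 3)) (Var 2))))))))))"

lemma tuple_tm:
  assumes "list_all2 (\<lambda>G g. computes G n g) Gs gs"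
  shows "closed (tuple_tm Gs)"
    and "length xs = n \<Longrightarrow> closed K \<Longrightarrow>
      wh\<^sup>*\<^sup>* (App (App (tuple_tm Gs) (enc xs)) K) (App K (enc (map (\<lambda>g. g xs) gs)))"
proof -
  have "closed (tuple_tm Gs) \<and> (\<forall>K. length xs = n \<longrightarrow> closed K \<longrightarrow>
      wh\<^sup>*\<^sup>* (App (App (tuple_tm Gs) (enc xs)) K) (App K (enc (map (\<lambda>g. g xs) gs))))"
    using assms
  proof (induction rule: list_all2_induct)
    case Nil
    show ?case by (auto intro!: whs_steps [of 2] closedI simp: eval_nat_numeral)
  next
    case (Cons G Gs g gs)
    let ?T = "tuple_tm Gs"
    from Cons have G: "closed G" and T: "closed ?T" by (auto dest: computes_closed)
    then have cl: "closed (tuple_tm (G # Gs))" by (auto intro: closedI)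
    moreover have "wh\<^sup>*\<^sup>* (App (App (tuple_tm (G # Gs)) (enc xs)) K)
      (App K (enc (map (\<lambda>g. g xs) (g # gs))))" if n: "length xs = n" and K: "closed K" for K
    proof -
      let ?K2 = "Lam (App K (Lam (Lam (App (App (Var 0) (num (g xs))) (Var 2)))))"
      have K2: "closed ?K2" using K by (intro closedI) simp_all
      let ?K1 = "Lam (App (App ?T (enc xs))
        (Lam (App K (Lam (Lam (App (App (Var 0) (Var 3)) (Var 2)))))))"
      have "wh\<^sup>*\<^sup>* (App (App (tuple_tm (G # Gs)) (enc xs)) K) (App (App G (enc xs)) ?K1)"
        using G T K by (intro whs_steps [of 2]) (simp add: eval_nat_numeral)
      also have "wh\<^sup>*\<^sup>* \<dots> (App ?K1 (num (g xs)))"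
        using Cons.hyps(1) n K T by (intro computesD) (auto intro: closedI)
      also (rtranclp_trans) have "wh\<^sup>*\<^sup>* \<dots> (App (App ?T (enc xs)) ?K2)"
        using T K by (intro whs_steps [of 1]) simp
      also (rtranclp_trans) have "wh\<^sup>*\<^sup>* \<dots> (App ?K2 (enc (map (\<lambda>g. g xs) gs)))"
        using Cons.IH n K2 by blast
      also (rtranclp_trans) have "wh\<^sup>*\<^sup>* \<dots> (App K (enc (map (\<lambda>g. g xs) (g # gs))))"
        using K by (intro whs_steps [of 1]) simp
      finally (rtranclp_trans) show ?thesis .
    qed
    ultimately show ?case by blast
  qed
  then show "closed (tuple_tm Gs)" and "length xs = n \<Longrightarrow> closed K \<Longrightarrow>
      wh\<^sup>*\<^sup>* (App (App (tuple_tm Gs) (enc xs)) K) (App K (enc (map (\<lambda>g. g xs) gs)))"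
    by blast+
qed

lemma computes_comp:
  assumes F: "computes F (length gs) f" and gs: "\<And>g. g \<in> set gs \<Longrightarrow> \<exists>G. computes G n g"
  shows "\<exists>F. computes F n (\<lambda>xs. f (map (\<lambda>g. g xs) gs))"
proof -
  from gs obtain G where "\<And>g. g \<in> set gs \<Longrightarrow> computes (G g) n g" by metis
  then have Gs: "list_all2 (\<lambda>G g. computes G n g) (map G gs) gs"
    by (simp add: list.rel_map list.rel_refl_strong)
  let ?T = "tuple_tm (map G gs)"
  let ?F = "Lam (Lam (App (App ?T (Var 1)) (Lam (App (App F (Var 0)) (Var 1)))))"
  note cl [simp] = computes_closed [OF F] tuple_tm(1) [OF Gs]
  have "computes ?F n (\<lambda>xs. f (map (\<lambda>g. g xs) gs))"
  proof (rule computesI)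
    show "closed ?F" by (rule closedI) simp_all
  next
    fix xs :: "nat list" and K
    assume n: "length xs = n" and K: "closed K"
    have "wh\<^sup>*\<^sup>* (App (App ?F (enc xs)) K) (App (App ?T (enc xs)) (Lam (App (App F (Var 0)) K)))"
      using K by (intro whs_steps [of 2]) (simp add: eval_nat_numeral)
    also have "wh\<^sup>*\<^sup>* \<dots> (App (Lam (App (App F (Var 0)) K)) (enc (map (\<lambda>g. g xs) gs)))"
      using K n by (intro tuple_tm(2) [OF Gs]) (auto intro: closedI)
    also (rtranclp_trans) have "wh\<^sup>*\<^sup>* \<dots> (App (App F (enc (map (\<lambda>g. g xs) gs))) K)"
      using K by (intro whs_steps [of 1]) simp
    also (rtranclp_trans) have "wh\<^sup>*\<^sup>* \<dots> (App K (num (f (map (\<lambda>g. g xs) gs))))"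
      using K by (intro computesD [OF F]) simp_all
    finally (rtranclp_trans) show "wh\<^sup>*\<^sup>* (App (App ?F (enc xs)) K) (App K (num (f (map (\<lambda>g. g xs) gs))))" .
  qed
  then show ?thesis ..
qed

lemma computes_prim_rec:
  assumes F: "computes F n f" and G: "computes G (Suc (Suc n)) g"
  shows "\<exists>F. computes F (Suc n)
    (\<lambda>xs. rec_nat (f (tl xs)) (\<lambda>k r. g (k # r # tl xs)) (hd xs))"
proof
  \<comment> \<open>In named form \<open>\<lambda>s m xs k. m (F xs k) (\<lambda>j. s s j xs
    (\<lambda>r. G (j # r # xs) k))\<close>: recursion by self-application, \<open>s\<close> always
    being \<open>?A\<close> itself.\<close>
  let ?A = "Lam (Lam (Lam (Lam (App (App (Var 2) (App (App F (Var 1)) (Var 0)))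
    (Lam (App (App (App (App (Var 4) (Var 4)) (Var 0)) (Var 2))
      (Lam (App (App G (Lam (Lam (App (App (Var 0) (Var 3))
        (Lam (Lam (App (App (Var 0) (Var 4)) (Var 7)))))))) (Var 2)))))))))"
  let ?F = "Lam (Lam (App (App (Var 1) (Var 1))
    (Lam (Lam (App (App (App (App ?A ?A) (Var 1)) (Var 0)) (Var 2))))))"
  note cl [simp] = computes_closed [OF F] computes_closed [OF G]
  have A [simp]: "closed ?A" by (rule closedI) simp_all
  have rec: "wh\<^sup>*\<^sup>* (App (App (App (App ?A ?A) (num m)) (enc xs)) K)
    (App K (num (rec_nat (f xs) (\<lambda>k r. g (k # r # xs)) m)))"
    if n: "length xs = n" and K: "closed K" for m xs K
    using K
  \<comment> \<open>The continuation has to vary because the recursive call runs with the longer one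
    that applies \<open>G\<close> to its result.\<close>
  proof (induction m arbitrary: K)
    case 0
    have "wh\<^sup>*\<^sup>* (App (App (App (App ?A ?A) (num 0)) (enc xs)) K) (App (App F (enc xs)) K)"
      using 0 by (intro whs_steps [of 6]) (simp add: eval_nat_numeral)
    with computesD [OF F n 0] show ?case by (auto intro: rtranclp_trans)
  next
    case (Suc m)
    let ?r = "rec_nat (f xs) (\<lambda>k r. g (k # r # xs)) m"
    let ?K = "Lam (App (App G (Lam (Lam (App (App (Var 0) (num m))
        (Lam (Lam (App (App (Var 0) (Var 4)) (enc xs)))))))) K)"
    have "wh\<^sup>*\<^sup>* (App (App (App (App ?A ?A) (num (Suc m))) (enc xs)) K)
        (App (App (App (App ?A ?A) (num m)) (enc xs)) ?K)"
      using Suc.prems by (intro whs_steps [of 7]) (simp add: eval_nat_numeral)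
    also have "wh\<^sup>*\<^sup>* \<dots> (App ?K (num ?r))"
      using Suc.prems by (intro Suc.IH) (auto intro: closedI)
    also (rtranclp_trans) have "wh\<^sup>*\<^sup>* \<dots> (App (App G (enc (m # ?r # xs))) K)"
      using Suc.prems by (intro whs_steps [of 1]) simp
    also (rtranclp_trans) have "wh\<^sup>*\<^sup>* \<dots> (App K (num (g (m # ?r # xs))))"
      using Suc.prems n by (intro computesD [OF G]) simp_all
    finally (rtranclp_trans) show ?case by simp
  qed
  show "computes ?F (Suc n) (\<lambda>xs. rec_nat (f (tl xs)) (\<lambda>k r. g (k # r # tl xs)) (hd xs))"
  proof (rule computesI)
    show "closed ?F" by (rule closedI) simp_all
  next
    fix xs :: "nat list" and K
    assume n: "length xs = Suc n" and K: "closed K"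
    then obtain y ys where xs: "xs = y # ys" by (cases xs) auto
    have "wh\<^sup>*\<^sup>* (App (App ?F (enc xs)) K) (App (App (App (App ?A ?A) (num y)) (enc ys)) K)"
      using xs K by (intro whs_steps [of 6]) (simp add: eval_nat_numeral)
    with rec [of ys K y] n K xs
    show "wh\<^sup>*\<^sup>* (App (App ?F (enc xs)) K)
      (App K (num (rec_nat (f (tl xs)) (\<lambda>k r. g (k # r # tl xs)) (hd xs))))"
      by (auto intro: rtranclp_trans)
  qed
qed

lemma computes_minim:
  assumes F: "computes F (Suc n) f" and ex: "\<And>xs. length xs = n \<Longrightarrow> \<exists>k. f (k # xs) = 0"
  shows "\<exists>F. computes F n (\<lambda>xs. LEAST k. f (k # xs) = 0)"
proof
  \<comment> \<open>In named form \<open>\<lambda>s z xs k. F (z # xs) (\<lambda>v. v (k z)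
    (\<lambda>_. s s (Suc z) xs k))\<close>: a value \<open>0\<close> ends the search, any other
    value continues it at \<open>Suc z\<close>.\<close>
  let ?A = "Lam (Lam (Lam (Lam (App (App F (Lam (Lam (App (App (Var 0) (Var 4)) (Var 3)))))
    (Lam (App (App (Var 0) (App (Var 1) (Var 3)))
      (Lam (App (App (App (App (Var 5) (Var 5)) (Lam (Lam (App (Var 0) (Var 6)))))
        (Var 3)) (Var 2)))))))))"
  let ?F = "Lam (Lam (App (App (App (App ?A ?A) (num 0)) (Var 1)) (Var 0)))"
  note cl [simp] = computes_closed [OF F]
  have A [simp]: "closed ?A" by (rule closedI) simp_all
  show "computes ?F n (\<lambda>xs. LEAST k. f (k # xs) = 0)"
  proof (rule computesI)
    show "closed ?F" by (rule closedI) simp_all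
  next
    fix xs :: "nat list" and K
    assume n: "length xs = n" and K: "closed K"
    let ?m = "LEAST k. f (k # xs) = 0"
    let ?K = "\<lambda>z. Lam (App (App (Var 0) (App K (num z)))
      (Lam (App (App (App (App ?A ?A) (Lam (Lam (App (Var 0) (num z))))) (enc xs)) K)))"
    have start: "wh\<^sup>*\<^sup>* (App (App (App (App ?A ?A) (num z)) (enc xs)) K)
      (App (?K z) (num (f (z # xs))))" for z
    proof -
      have "wh\<^sup>*\<^sup>* (App (App (App (App ?A ?A) (num z)) (enc xs)) K)
          (App (App F (enc (z # xs))) (?K z))"
        using K by (intro whs_steps [of 4]) (simp add: eval_nat_numeral)
      also have "wh\<^sup>*\<^sup>* \<dots> (App (?K z) (num (f (z # xs))))"
        using n K by (intro computesD [OF F]) (auto intro!: closedI)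
      finally (rtranclp_trans) show ?thesis .
    qed
    have m: "f (?m # xs) = 0" using ex [OF n] by (rule LeastI_ex)
    have "wh\<^sup>*\<^sup>* (App (App (App (App ?A ?A) (num z)) (enc xs)) K) (App K (num ?m))"
      if "z \<le> ?m" for z
      using that
    \<comment> \<open>Downward induction from the least zero \<open>?m\<close>; each
      \<open>z\<close> below it costs one more round.\<close>
    proof (induction rule: inc_induct)
      case base
      have "wh\<^sup>*\<^sup>* (App (?K ?m) (num (f (?m # xs)))) (App K (num ?m))"
        using m K by (intro whs_steps [of 3]) (simp add: eval_nat_numeral)
      with start show ?case by (rule rtranclp_trans)
    next
      case (step z)
      then have "f (z # xs) \<noteq> 0" by (auto dest: not_less_Least)
      then obtain j where j: "f (z # xs) = Suc j" by (auto simp: gr0_conv_Suc)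
      have "wh\<^sup>*\<^sup>* (App (?K z) (num (f (z # xs)))) (App (App (App (App ?A ?A) (num (Suc z))) (enc xs)) K)"
        using j K by (intro whs_steps [of 4]) (simp add: eval_nat_numeral)
      with start have "wh\<^sup>*\<^sup>* (App (App (App (App ?A ?A) (num z)) (enc xs)) K)
        (App (App (App (App ?A ?A) (num (Suc z))) (enc xs)) K)" by (rule rtranclp_trans)
      then show ?case using step.IH by (rule rtranclp_trans)
    qed
    from this [of 0] have "wh\<^sup>*\<^sup>* (App (App (App (App ?A ?A) (num 0)) (enc xs)) K) (App K (num ?m))"
      by simp
    moreover have "wh\<^sup>*\<^sup>* (App (App ?F (enc xs)) K) (App (App (App (App ?A ?A) (num 0)) (enc xs)) K)"
      using K by (intro whs_steps [of 2]) (simp add: eval_nat_numeral)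
    ultimately show "wh\<^sup>*\<^sup>* (App (App ?F (enc xs)) K) (App K (num ?m))"
      by (meson rtranclp_trans)
  qed
qed

theorem recursive_fun_computes: "recursive_fun n f \<Longrightarrow> \<exists>F. computes F n f"
proof (induction rule: recursive_fun.induct)
  case (proj i n)
  then have "computes (proj_tm i) n (\<lambda>xs. xs ! i)"
    by (intro computesI proj_tm) simp_all
  then show ?case ..
next
  case (comp gs f n)
  then show ?case using computes_comp by blast
next
  case (prim_rec n f g)
  then show ?case using computes_prim_rec by blast
next
  case (minim n f)
  then show ?case using computes_minim by blast
qed (rule computes_zero computes_succ)+


section \<open>Infinite outputs guarded by searches\<close>

text \<open>The term \<open>search_tm F x k z\<close> looks for some \<open>z' \<ge> z\<close> with \<open>f [x, k, z'] \<noteq> 0\<close>; when it has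
  found one, it outputs one node \<open>\<lambda>v. v \<dots>\<close> and starts the search for \<open>k + 1\<close>.\<close>

definition search_body :: "tm \<Rightarrow> tm" where
  "search_body F = Lam (Lam (Lam (Lam
    (App (App F (Lam (Lam (App (App (Var 0) (Var 4)) (Lam (Lam (App (App (Var 0) (Var 5))
        (Lam (Lam (App (App (Var 0) (Var 6)) (enc [])))))))))))
      (Lam (App (App (Var 0)
        (App (App (App (App (Var 4) (Var 4)) (Var 3)) (Var 2)) (Lam (Lam (App (Var 0) (Var 3))))))
        (Lam (Lam (App (Var 0)
          (App (App (App (App (Var 6) (Var 6)) (Var 5)) (Lam (Lam (App (Var 0) (Var 6))))) (num 0)))))))))))"

definition search_tm :: "tm \<Rightarrow> nat \<Rightarrow> nat \<Rightarrow> nat \<Rightarrow> tm" where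
  "search_tm F x k z =
    App (App (App (App (search_body F) (search_body F)) (num x)) (num k)) (num z)"

text \<open>The term \<open>N\<close> of the outline: the self-application of
  \<open>\<lambda>s v. v (s s)\<close> solves the equation
  \<open>N = \<lambda>v. v N\<close>.\<close>

definition stream_tm :: tm where
  "stream_tm = App (Lam (Lam (App (Var 0) (App (Var 1) (Var 1)))))
    (Lam (Lam (App (Var 0) (App (Var 1) (Var 1)))))"

lemma closed_stream_tm [simp]: "closed stream_tm"
  by (rule closedI) (simp_all add: stream_tm_def)

lemma stream_tm: "wh\<^sup>+\<^sup>+ stream_tm (Lam (App (Var 0) stream_tm))"
  by (rule tranclp.r_into_trancl)
    (use wh.redex [of "Lam (App (Var 0) (App (Var 1) (Var 1)))"
      "Lam (Lam (App (Var 0) (App (Var 1) (Var 1))))"] in \<open>simp add: stream_tm_def\<close>)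

text \<open>Normal forms and head normal forms are weak head normal forms, so divergence of weak
  head reduction refutes all three properties at once.\<close>

lemma reduces_into_whnf:
  assumes "reduces_into P t" and P: "P \<in> {is_nf, is_hnf, is_whnf}"
  shows "\<exists>u. wh\<^sup>*\<^sup>* t u \<and> is_whnf u"
proof -
  have "is_whnf u" if "P u" for u
  proof -
    have "is_whnf u" if "is_nf u"
      using that by (cases rule: nf_cases) simp_all
    moreover have "is_whnf u" if u: "is_hnf u"
    proof -
      from u obtain n y Ns where "u = (Lam ^^ n) (neutral y Ns)" by (auto simp: is_hnf_def)
      then show ?thesis by (cases n) auto
    qed
    ultimately show ?thesis using P \<open>P u\<close> by auto
  qed
  then have "reduces_into is_whnf t" using assms(1) by (auto simp: reduces_into_def)
  then show ?thesis by (simp add: reduces_into_whnf_iff)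
qed

primrec app_ctxt :: "nat \<Rightarrow> tm \<Rightarrow> ctxt" where
  "app_ctxt 0 t = Hole"
| "app_ctxt (Suc k) t = AppL (app_ctxt k t) t"

text \<open>Applying a node to the identity uncovers its content; the separating context uses this
  to walk from one search to the next.\<close>

lemma node_App: "closed s \<Longrightarrow> wh\<^sup>+\<^sup>+ t (Lam (App (Var 0) s)) \<Longrightarrow> wh\<^sup>*\<^sup>* (App t (Lam (Var 0))) s"
proof -
  assume s: "closed s" and "wh\<^sup>+\<^sup>+ t (Lam (App (Var 0) s))"
  then have "wh\<^sup>*\<^sup>* (App t (Lam (Var 0))) (App (Lam (App (Var 0) s)) (Lam (Var 0)))"
    by (auto intro: whs_App)
  also have "wh\<^sup>*\<^sup>* \<dots> s" using s by (intro whs_steps [of 2]) (simp add: eval_nat_numeral)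
  finally show ?thesis .
qed

context
  fixes F f
  assumes F: "computes F 3 f" and f: "\<And>x y z. f [x, y, z] \<in> {0, 1}"
begin

lemma closed_search_body [simp]: "closed (search_body F)"
  using computes_closed [OF F] by (intro closedI) (simp_all add: search_body_def)

lemma closed_search_tm [simp]: "closed (search_tm F x k z)"
  by (simp add: search_tm_def)

text \<open>One round of the search. At least one weak head step is guaranteed, as simulations and
  the divergence argument both require.\<close>

lemma search_tm:
  "wh\<^sup>+\<^sup>+ (search_tm F x k z) (if f [x, k, z] = 0 then search_tm F x k (Suc z)
     else Lam (App (Var 0) (search_tm F x (Suc k) 0)))"
proof -
  note cl [simp] = computes_closed [OF F]
  let ?A = "search_body F"
  \<comment> \<open>The continuation that receives the value of \<open>f\<close>: on
    \<open>0\<close> it goes on with \<open>Suc z\<close>; on \<open>1\<close> it drops the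
    predecessor and outputs a node that restarts the search at \<open>Suc k\<close> and
    \<open>0\<close>.\<close>
  let ?K = "Lam (App (App (Var 0)
    (App (App (App (App ?A ?A) (num x)) (num k)) (Lam (Lam (App (Var 0) (num z))))))
    (Lam (Lam (App (Var 0)
      (App (App (App (App ?A ?A) (num x)) (Lam (Lam (App (Var 0) (num k))))) (num 0))))))"
  let ?u = "App (App F (enc [x, k, z])) ?K"
  obtain b where b: "?A = Lam b" by (simp add: search_body_def)
  have step1: "wh (search_tm F x k z) (step (search_tm F x k z))"
    unfolding search_tm_def b by (auto intro!: wh.intros)
  have "(step ^^ 4) (search_tm F x k z) = ?u"
  proof -
    show ?thesis
      unfolding search_tm_def
      \<comment> \<open>Only the head copy is unfolded; the copies among the arguments stay folded,
        as they are in \<open>?K\<close>.\<close>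
      by (subst (1) search_body_def) (simp add: eval_nat_numeral)
  qed
  then have "(step ^^ 3) (step (search_tm F x k z)) = ?u" by (simp add: eval_nat_numeral)
  then have "wh\<^sup>*\<^sup>* (step (search_tm F x k z)) ?u" by (rule whs_steps)
  with step1 have "wh\<^sup>+\<^sup>+ (search_tm F x k z) ?u" by (rule rtranclp_into_tranclp2)
  moreover have "wh\<^sup>*\<^sup>* ?u (App ?K (num (f [x, k, z])))"
    by (rule computesD [OF F], simp, rule closedI) simp_all
  ultimately have "wh\<^sup>+\<^sup>+ (search_tm F x k z) (App ?K (num (f [x, k, z])))"
    by (rule tranclp_rtranclp_tranclp)
  moreover have "wh\<^sup>*\<^sup>* (App ?K (num 0)) (search_tm F x k (Suc z))"
    by (rule whs_steps [of 3]) (simp add: eval_nat_numeral search_tm_def)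
  moreover have "wh\<^sup>*\<^sup>* (App ?K (num 1)) (Lam (App (Var 0) (search_tm F x (Suc k) 0)))"
    by (rule whs_steps [of 4]) (simp add: eval_nat_numeral search_tm_def)
  ultimately show ?thesis using f [of x k z] by (auto intro: tranclp_rtranclp_tranclp)
qed

lemma search_tm_found:
  assumes "\<exists>z. f [x, k, z] = 1"
  shows "wh\<^sup>+\<^sup>+ (search_tm F x k 0) (Lam (App (Var 0) (search_tm F x (Suc k) 0)))"
proof -
  let ?m = "LEAST z. f [x, k, z] = 1"
  have m: "f [x, k, ?m] = 1" using assms by (rule LeastI_ex)
  have "wh\<^sup>+\<^sup>+ (search_tm F x k z) (Lam (App (Var 0) (search_tm F x (Suc k) 0)))" if "z \<le> ?m" for z
    using that
  proof (induction rule: inc_induct)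
    case base
    show ?case using search_tm [of x k ?m] m by simp
  next
    case (step z)
    then have "f [x, k, z] = 0" using f [of x k z] not_less_Least by blast
    then show ?case using search_tm [of x k z] step.IH by (auto intro: tranclp_trans)
  qed
  then show ?thesis by simp
qed

text \<open>Infinite descent: a reduction into \<open>u\<close> would get shorter with every failing
  round, hence the induction on its length with \<open>z\<close> arbitrary.\<close>

lemma search_tm_diverges:
  assumes "\<And>z. f [x, k, z] = 0" and u: "is_whnf u"
  shows "\<not> wh\<^sup>*\<^sup>* (App (search_tm F x k 0) t) u"
proof -
  have "\<not> (wh ^^ n) (App (search_tm F x k z) t) u" for n z
  proof (induction n arbitrary: z rule: less_induct)
    case (less n)
    have "wh\<^sup>+\<^sup>+ (App (search_tm F x k z) t) (App (search_tm F x k (Suc z)) t)"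
      using search_tm [of x k z] assms by (simp add: whp_App)
    then show ?case using less.IH u by (meson whnf_progress)
  qed
  then show ?thesis by (simp add: rtranclp_power)
qed

text \<open>All stages \<open>k\<close> are related to the same term, so the relation survives
  passing to the next node.\<close>

inductive node_eq :: "nat \<Rightarrow> tm \<Rightarrow> tm \<Rightarrow> bool" for x where
  "node_eq x (search_tm F x k 0) stream_tm"

text \<open>When all searches succeed, each side takes at least one step to its node, hence the
  relation and its converse are both simulations. They give the two implications of
  \<open>obs_eq\<close>.\<close>

lemma simulation_search:
  assumes "\<And>k. \<exists>z. f [x, k, z] = 1"
  shows "simulation (node_eq x)" and "simulation (node_eq x)\<inverse>\<inverse>"
proof -
  have *: "wh\<^sup>+\<^sup>+ (search_tm F x k 0) (Lam (App (Var 0) (search_tm F x (Suc k) 0)))" for k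
    using assms by (rule search_tm_found)
  show "simulation (node_eq x)"
    unfolding simulation_def
    using * tranclp_into_rtranclp [OF stream_tm]
    by (auto elim!: node_eq.cases intro!: exI sim_App sim_Var intro: sim_base node_eq.intros)
  show "simulation (node_eq x)\<inverse>\<inverse>"
    unfolding simulation_def
    using tranclp_into_rtranclp [OF *] stream_tm
    by (auto elim!: node_eq.cases intro!: exI sim_App sim_Var intro: sim_base node_eq.intros)
qed

lemma obs_eq_search_tm:
  assumes "\<And>k. \<exists>z. f [x, k, z] = 1" and P: "P \<in> {is_nf, is_hnf, is_whnf}"
  shows "obs_eq P (search_tm F x 0 0) stream_tm"
proof -
  have "reduces_into P t" if "simulation B" "sim B s t" "reduces_into P s" for B s t
    using that P sim_reduces_into_nf sim_reduces_into_hnf sim_reduces_into_whnf by blast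
  moreover have "sim (node_eq x) (fill C (search_tm F x 0 0)) (fill C stream_tm)"
    "sim (node_eq x)\<inverse>\<inverse> (fill C stream_tm) (fill C (search_tm F x 0 0))" for C
    by (auto intro: sim_fill node_eq.intros)
  ultimately show ?thesis
    unfolding obs_eq_def using simulation_search [OF assms(1)] by blast
qed

lemma not_obs_eq_search_tm:
  assumes k: "\<And>z. f [x, k, z] = 0" and P: "P \<in> {is_nf, is_hnf, is_whnf}"
  shows "\<not> obs_eq P (search_tm F x 0 0) stream_tm"
proof -
  \<comment> \<open>The least failing index: all searches before it succeed, so that
    \<open>m\<close> identities lead the context exactly to the search that diverges.\<close>
  define m where "m = (LEAST k. \<forall>z. f [x, k, z] = 0)"
  have m: "f [x, m, z] = 0" for z
    using LeastI [of "\<lambda>k. \<forall>z. f [x, k, z] = 0" k] k unfolding m_def by blast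
  have below: "\<exists>z. f [x, j, z] = 1" if "j < m" for j
    using not_less_Least [of j "\<lambda>k. \<forall>z. f [x, k, z] = 0"] that f [of x j] unfolding m_def by blast
  let ?I = "Lam (Var 0)"
  \<comment> \<open>\<open>Lam ?I\<close> is \<open>K I\<close>: it discards the rest of the stream
    and leaves \<open>I\<close>, a normal form of every kind, whereas a diverging search never lets
    it act.\<close>
  let ?C = "AppL (app_ctxt m ?I) (Lam ?I)"
  have S: "wh\<^sup>*\<^sup>* (fill (app_ctxt j ?I) stream_tm) stream_tm" for j
  proof (induction j)
    case (Suc j)
    then have "wh\<^sup>*\<^sup>* (fill (app_ctxt (Suc j) ?I) stream_tm) (App stream_tm ?I)"
      by (simp add: whs_App)
    also have "wh\<^sup>*\<^sup>* \<dots> stream_tm" by (intro node_App stream_tm) simp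
    finally show ?case .
  qed simp
  have W: "wh\<^sup>*\<^sup>* (fill (app_ctxt j ?I) (search_tm F x 0 0)) (search_tm F x j 0)" if "j \<le> m" for j
    using that
  proof (induction j)
    case (Suc j)
    then have "wh\<^sup>*\<^sup>* (fill (app_ctxt (Suc j) ?I) (search_tm F x 0 0)) (App (search_tm F x j 0) ?I)"
      by (simp add: whs_App)
    also have "wh\<^sup>*\<^sup>* \<dots> (search_tm F x (Suc j) 0)"
      using Suc.prems by (intro node_App search_tm_found below) simp_all
    finally show ?case .
  qed simp
  have "wh\<^sup>*\<^sup>* (fill ?C stream_tm) (App stream_tm (Lam ?I))" using S by (simp add: whs_App)
  also have "wh\<^sup>*\<^sup>* \<dots> (App (Lam (App (Var 0) stream_tm)) (Lam ?I))"
    using stream_tm by (simp add: whs_App tranclp_into_rtranclp)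
  also have "wh\<^sup>*\<^sup>* \<dots> ?I" by (intro whs_steps [of 2]) (simp add: eval_nat_numeral)
  finally have "beta\<^sup>*\<^sup>* (fill ?C stream_tm) ?I" by (rule whs_betas)
  moreover have "is_hnf ?I"
    unfolding is_hnf_def by (intro exI [of _ 1] exI [of _ 0] exI [of _ "[]"]) simp
  ultimately have "reduces_into P (fill ?C stream_tm)"
    using P unfolding reduces_into_def by (intro exI [of _ ?I]) auto
  moreover have "\<not> reduces_into P (fill ?C (search_tm F x 0 0))"
  proof
    assume "reduces_into P (fill ?C (search_tm F x 0 0))"
    then obtain u where u: "wh\<^sup>*\<^sup>* (fill ?C (search_tm F x 0 0)) u" "is_whnf u"
      using reduces_into_whnf P by blast
    have *: "wh\<^sup>*\<^sup>* (fill ?C (search_tm F x 0 0)) (App (search_tm F x m 0) (Lam ?I))"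
      using W [of m] by (simp add: whs_App)
    have "wh\<^sup>*\<^sup>* (App (search_tm F x m 0) (Lam ?I)) u"
    \<comment> \<open>\<open>whnf_progress\<close> asks for at least one step, and for
      \<open>m = 0\<close> there is none to make.\<close>
    proof (cases "fill ?C (search_tm F x 0 0) = App (search_tm F x m 0) (Lam ?I)")
      case True
      with u show ?thesis by simp
    next
      case False
      with * have "wh\<^sup>+\<^sup>+ (fill ?C (search_tm F x 0 0)) (App (search_tm F x m 0) (Lam ?I))"
        by (meson rtranclpD)
      with u show ?thesis by (meson rtranclp_power whnf_progress)
    qed
    with search_tm_diverges [OF m u(2)] show False by blast
  qed
  ultimately show ?thesis unfolding obs_eq_def by blast
qed

end

section \<open>Computability: recursive functions, decidable and semidecidable predicates\<close>

section \<open>Computable functions of one argument\<close>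

text \<open>\<open>recursive_fun\<close> fixes a function on lists of every length. Asking for
  agreement only at length \<open>n\<close> allows rewriting by equations that hold just
  there.\<close>

definition rec_on :: "nat \<Rightarrow> (nat list \<Rightarrow> nat) \<Rightarrow> bool" where
  "rec_on n f \<longleftrightarrow> (\<exists>g. recursive_fun n g \<and> (\<forall>xs. length xs = n \<longrightarrow> g xs = f xs))"

lemma rec_on_cong: "rec_on n f \<Longrightarrow> (\<And>xs. length xs = n \<Longrightarrow> f xs = g xs) \<Longrightarrow> rec_on n g"
  unfolding rec_on_def by metis

lemma rec_on_proj: "i < n \<Longrightarrow> rec_on n (\<lambda>xs. xs ! i)"
  unfolding rec_on_def by (blast intro: recursive_fun.proj)

lemma rec_on_comp:
  assumes "rec_on (length gs) f" "\<And>g. g \<in> set gs \<Longrightarrow> rec_on n g"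
  shows "rec_on n (\<lambda>xs. f (map (\<lambda>g. g xs) gs))"
proof -
  from assms(1) obtain f' where f': "recursive_fun (length gs) f'"
    "\<And>xs. length xs = length gs \<Longrightarrow> f' xs = f xs" by (auto simp: rec_on_def)
  from assms(2) obtain h where h: "\<And>g. g \<in> set gs \<Longrightarrow> recursive_fun n (h g)"
    "\<And>g xs. g \<in> set gs \<Longrightarrow> length xs = n \<Longrightarrow> h g xs = g xs"
    unfolding rec_on_def by metis
  have "recursive_fun n (\<lambda>xs. f' (map (\<lambda>g. g xs) (map h gs)))"
    using f'(1) h(1) by (intro recursive_fun.comp) auto
  moreover have "f' (map (\<lambda>g. g xs) (map h gs)) = f (map (\<lambda>g. g xs) gs)" if "length xs = n" for xs
    using that h(2) f'(2) [of "map (\<lambda>g. g xs) gs"] by (simp add: comp_def cong: map_cong)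
  ultimately show ?thesis unfolding rec_on_def by blast
qed

lemma rec_on_comp1: "rec_on 1 f \<Longrightarrow> rec_on n a \<Longrightarrow> rec_on n (\<lambda>xs. f [a xs])"
  using rec_on_comp [of "[a]" f n] by simp

lemma rec_on_Suc: "rec_on n a \<Longrightarrow> rec_on n (\<lambda>xs. Suc (a xs))"
  using rec_on_comp1 [of "\<lambda>xs. Suc (xs ! 0)" n a] recursive_fun.succ by (auto simp: rec_on_def)

lemma rec_on_const: "rec_on n (\<lambda>xs. c)"
proof (induction c)
  case 0
  show ?case unfolding rec_on_def by (blast intro: recursive_fun.zero)
qed (rule rec_on_Suc)

text \<open>The scheme \<open>prim_rec\<close> recurses on its first argument; composing it with
  \<open>a\<close> and all projections recurses on a computed value and keeps \<open>xs\<close> as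
  the parameters.\<close>

lemma rec_on_rec:
  assumes "rec_on n a" "rec_on n f" "rec_on (Suc (Suc n)) g"
  shows "rec_on n (\<lambda>xs. rec_nat (f xs) (\<lambda>k r. g (k # r # xs)) (a xs))"
proof -
  from assms obtain f' g' where f': "recursive_fun n f'" "\<And>xs. length xs = n \<Longrightarrow> f' xs = f xs"
    and g': "recursive_fun (Suc (Suc n)) g'" "\<And>xs. length xs = Suc (Suc n) \<Longrightarrow> g' xs = g xs"
    by (auto simp: rec_on_def)
  let ?R = "\<lambda>xs. rec_nat (f' (tl xs)) (\<lambda>k r. g' (k # r # tl xs)) (hd xs)"
  let ?gs = "a # map (\<lambda>i xs. xs ! i) [0..<n]"
  have "recursive_fun (Suc n) ?R" using f'(1) g'(1) by (rule recursive_fun.prim_rec)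
  then have "rec_on (length ?gs) ?R" by (auto simp: rec_on_def)
  then have "rec_on n (\<lambda>xs. ?R (map (\<lambda>g. g xs) ?gs))"
    by (rule rec_on_comp) (use assms(1) in \<open>auto intro: rec_on_proj\<close>)
  then show ?thesis
  proof (rule rec_on_cong)
    fix xs :: "nat list"
    assume n: "length xs = n"
    have "map (\<lambda>i. xs ! i) [0..<n] = xs" using n by (auto intro: nth_equalityI)
    then have "?R (map (\<lambda>g. g xs) ?gs) = rec_nat (f' xs) (\<lambda>k r. g' (k # r # xs)) (a xs)"
      by (simp add: comp_def)
    also have "\<dots> = rec_nat (f xs) (\<lambda>k r. g (k # r # xs)) (a xs)" using n by (simp add: f' g')
    finally show "?R (map (\<lambda>g. g xs) ?gs) = rec_nat (f xs) (\<lambda>k r. g (k # r # xs)) (a xs)" .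
  qed
qed

lemma rec_on_minim:
  assumes "rec_on (Suc n) f" and "\<And>xs. length xs = n \<Longrightarrow> \<exists>k. f (k # xs) = 0"
  shows "rec_on n (\<lambda>xs. LEAST k. f (k # xs) = 0)"
proof -
  from assms(1) obtain f' where f': "recursive_fun (Suc n) f'"
    "\<And>xs. length xs = Suc n \<Longrightarrow> f' xs = f xs" by (auto simp: rec_on_def)
  then have "recursive_fun n (\<lambda>xs. LEAST k. f' (k # xs) = 0)"
    using assms(2) by (intro recursive_fun.minim) simp_all
  then show ?thesis using f'(2) by (auto simp: rec_on_def)
qed

lemma rec_on_add: "rec_on n a \<Longrightarrow> rec_on n b \<Longrightarrow> rec_on n (\<lambda>xs. a xs + b xs)"
proof -
  have "rec_nat u (\<lambda>_. Suc) v = u + v" for u v by (induction v) auto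
  then show "rec_on n a \<Longrightarrow> rec_on n b \<Longrightarrow> ?thesis"
    using rec_on_rec [of n b a "\<lambda>ys. Suc (ys ! 1)"] by (simp add: rec_on_Suc rec_on_proj)
qed

lemma rec_on_diff: "rec_on n a \<Longrightarrow> rec_on n b \<Longrightarrow> rec_on n (\<lambda>xs. a xs - b xs)"
proof -
  have pred: "rec_on m (\<lambda>xs. c xs - 1)" if "rec_on m c" for m c
  proof -
    have "rec_nat 0 (\<lambda>k _. k) v = v - 1" for v :: nat by (induction v) auto
    then show ?thesis using rec_on_rec [of m c "\<lambda>_. 0" "\<lambda>ys. ys ! 0"] that
      by (simp add: rec_on_const rec_on_proj)
  qed
  have "rec_nat u (\<lambda>_ r. r - 1) v = u - v" for u v :: nat by (induction v) auto
  then show "rec_on n a \<Longrightarrow> rec_on n b \<Longrightarrow> ?thesis"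
    using rec_on_rec [of n b a "\<lambda>ys. ys ! 1 - 1"] pred by (simp add: rec_on_proj)
qed

lemma rec_on_triangle: "rec_on n a \<Longrightarrow> rec_on n (\<lambda>xs. triangle (a xs))"
proof -
  have "rec_nat 0 (\<lambda>k r. r + Suc k) v = triangle v" for v by (induction v) auto
  then show "rec_on n a \<Longrightarrow> ?thesis"
    using rec_on_rec [of n a "\<lambda>_. 0" "\<lambda>ys. ys ! 1 + Suc (ys ! 0)"]
    by (simp add: rec_on_const rec_on_proj rec_on_Suc rec_on_add del: add_Suc_right)
qed

definition pr :: "nat \<Rightarrow> nat \<Rightarrow> nat" where "pr a b = prod_encode (a, b)"
definition p1 :: "nat \<Rightarrow> nat" where "p1 n = fst (prod_decode n)"
definition p2 :: "nat \<Rightarrow> nat" where "p2 n = snd (prod_decode n)"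

lemma p_pr [simp]: "p1 (pr a b) = a" "p2 (pr a b) = b" "pr (p1 n) (p2 n) = n"
  by (simp_all add: p1_def p2_def pr_def)

text \<open>By truncated subtraction the equation means \<open>pr a b < triangle (Suc s)\<close>, so
  minimization finds the diagonal \<open>a + b\<close> on which the pair lies. This is how pairing
  is inverted by a recursive function.\<close>

lemma diagonal_pr: "(LEAST s. Suc (pr a b) - triangle (Suc s) = 0) = a + b"
proof (rule Least_equality)
  show "Suc (pr a b) - triangle (Suc (a + b)) = 0"
    by (simp add: pr_def prod_encode_def)
next
  fix s
  assume s: "Suc (pr a b) - triangle (Suc s) = 0"
  have "triangle (Suc s) \<le> triangle (a + b)" if "Suc s \<le> a + b"
    using that by (induction rule: dec_induct) auto
  with s show "a + b \<le> s" by (force simp: pr_def prod_encode_def)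
qed

text \<open>Several arguments are packed by \<open>pr\<close>, so one arity suffices and
  computability is proved by introduction rules that follow the syntax of an expression.\<close>

definition computable :: "(nat \<Rightarrow> nat) \<Rightarrow> bool" where
  "computable f \<longleftrightarrow> rec_on 1 (\<lambda>xs. f (xs ! 0))"

named_theorems computable_intros

lemma computable_iff: "computable f \<longleftrightarrow> (\<exists>g. recursive_fun 1 g \<and> (\<forall>x. g [x] = f x))"
  by (auto simp: computable_def rec_on_def length_Suc_conv)

lemma computable_id [computable_intros]: "computable (\<lambda>x. x)"
  and computable_const [computable_intros]: "computable (\<lambda>x. c)"
  by (simp_all add: computable_def rec_on_proj rec_on_const)

lemma rec_on_computable: "computable f \<Longrightarrow> rec_on n a \<Longrightarrow> rec_on n (\<lambda>xs. f (a xs))"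
  using rec_on_comp1 [of "\<lambda>xs. f (xs ! 0)" n a] by (simp add: computable_def)

lemma computable_comp: "computable f \<Longrightarrow> computable g \<Longrightarrow> computable (\<lambda>x. f (g x))"
  unfolding computable_def [of g] computable_def [of "\<lambda>x. f (g x)"] by (rule rec_on_computable)

lemma computable_Suc [computable_intros]: "computable f \<Longrightarrow> computable (\<lambda>x. Suc (f x))"
  and computable_add [computable_intros]:
    "computable f \<Longrightarrow> computable g \<Longrightarrow> computable (\<lambda>x. f x + g x)"
  and computable_diff [computable_intros]:
    "computable f \<Longrightarrow> computable g \<Longrightarrow> computable (\<lambda>x. f x - g x)"
  by (simp_all add: computable_def rec_on_Suc rec_on_add rec_on_diff)

lemma computable_times3 [computable_intros]: "computable f \<Longrightarrow> computable (\<lambda>x. 3 * f x)"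
proof -
  assume "computable f"
  then have "computable (\<lambda>x. f x + (f x + f x))" by (intro computable_add)
  moreover have "f x + (f x + f x) = 3 * f x" for x by simp
  ultimately show ?thesis by (simp only:)
qed

lemma rec_on_pr: "rec_on n a \<Longrightarrow> rec_on n b \<Longrightarrow> rec_on n (\<lambda>xs. pr (a xs) (b xs))"
  by (simp add: pr_def prod_encode_def rec_on_add rec_on_triangle)

lemma computable_pr [computable_intros]:
  "computable f \<Longrightarrow> computable g \<Longrightarrow> computable (\<lambda>x. pr (f x) (g x))"
  by (simp add: computable_def rec_on_pr)

lemma computable_p1_p2: "computable p1" "computable p2"
proof -
  define d where "d n = (LEAST s. Suc n - triangle (Suc s) = 0)" for n
  have d: "d n = p1 n + p2 n" for n using diagonal_pr [of "p1 n" "p2 n"] by (simp add: d_def)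
  have "rec_on 1 (\<lambda>xs. LEAST s. (\<lambda>ys. Suc (ys ! 1) - triangle (Suc (ys ! 0))) (s # xs) = 0)"
  proof (rule rec_on_minim)
    show "rec_on (Suc 1) (\<lambda>ys. Suc (ys ! 1) - triangle (Suc (ys ! 0)))"
      by (intro rec_on_diff rec_on_Suc rec_on_triangle rec_on_proj) simp_all
    show "\<exists>k. Suc ((k # xs) ! 1) - triangle (Suc ((k # xs) ! 0)) = 0" for xs :: "nat list"
      by (rule exI [of _ "xs ! 0"]) simp
  qed
  then have D: "rec_on 1 (\<lambda>xs. d (xs ! 0))" by (simp add: d_def)
  \<comment> \<open>\<open>d n\<close> is the diagonal of \<open>n\<close>, and \<open>p1 n\<close>
    is the offset of \<open>n\<close> on it.\<close>
  have "pr a b = triangle (a + b) + a" for a b by (simp add: pr_def prod_encode_def)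
  from this [of "p1 n" "p2 n" for n] have "p1 n = n - triangle (d n)" for n
    using d [of n] by (metis p_pr(3) add_diff_cancel_left')
  then have "rec_on 1 (\<lambda>xs. p1 (xs ! 0))"
    using D by (simp add: rec_on_diff rec_on_triangle rec_on_proj)
  moreover from this D have "rec_on 1 (\<lambda>xs. d (xs ! 0) - p1 (xs ! 0))" by (intro rec_on_diff)
  ultimately show "computable p1" "computable p2" by (simp_all add: computable_def d)
qed

lemmas computable_p1 [computable_intros] = computable_comp [OF computable_p1_p2(1)]
lemmas computable_p2 [computable_intros] = computable_comp [OF computable_p1_p2(2)]

lemma computable_rec [computable_intros]:
  assumes "computable a" "computable f" "computable (\<lambda>p. g (p1 p) (p1 (p2 p)) (p2 (p2 p)))"
  shows "computable (\<lambda>x. rec_nat (f x) (\<lambda>k r. g k r x) (a x))"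
proof -
  have "rec_on 3 (\<lambda>ys. pr (ys ! 0) (pr (ys ! 1) (ys ! 2)))"
    by (intro rec_on_pr rec_on_proj) simp_all
  from rec_on_computable [OF assms(3) this]
  have "rec_on 3 (\<lambda>ys. g (ys ! 0) (ys ! 1) (ys ! 2))" by simp
  then show ?thesis
    using rec_on_rec [of 1 "\<lambda>xs. a (xs ! 0)" "\<lambda>xs. f (xs ! 0)" "\<lambda>ys. g (ys ! 0) (ys ! 1) (ys ! 2)"]
      assms(1,2) by (simp add: computable_def eval_nat_numeral)
qed

section \<open>Decidable predicates\<close>

definition decidable :: "(nat \<Rightarrow> bool) \<Rightarrow> bool" where
  "decidable P \<longleftrightarrow> computable (\<lambda>x. if P x then 1 else 0)"

lemma decidable_comp: "decidable P \<Longrightarrow> computable f \<Longrightarrow> decidable (\<lambda>x. P (f x))"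
  unfolding decidable_def by (rule computable_comp)

lemma computable_if [computable_intros]:
  assumes "decidable P" "computable f" "computable g"
  shows "computable (\<lambda>x. if P x then f x else g x)"
proof -
  have "computable (\<lambda>x. rec_nat (g x) (\<lambda>_ _. f x) (if P x then 1 else 0))"
    using assms unfolding decidable_def
    by (intro computable_rec) (auto intro!: computable_intros intro: computable_comp)
  also have "(\<lambda>x. rec_nat (g x) (\<lambda>_ _. f x) (if P x then 1 else 0)) = (\<lambda>x. if P x then f x else g x)"
    by auto
  finally show ?thesis .
qed

lemma decidable_not [computable_intros]: "decidable P \<Longrightarrow> decidable (\<lambda>x. \<not> P x)"
proof -
  assume "decidable P"
  then have "computable (\<lambda>x. if P x then 0 else 1)" by (intro computable_intros)
  moreover have "(if a then 0 else 1) = (if \<not> a then 1 else 0 :: nat)" for a by simp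
  ultimately show ?thesis by (simp only: decidable_def)
qed

lemma decidable_conj [computable_intros]: "decidable P \<Longrightarrow> decidable Q \<Longrightarrow> decidable (\<lambda>x. P x \<and> Q x)"
proof -
  assume "decidable P" "decidable Q"
  then have "computable (\<lambda>x. if P x then if Q x then 1 else 0 else 0)"
    by (intro computable_intros)
  moreover have "(if a then if b then 1 else 0 else 0) = (if a \<and> b then 1 else 0 :: nat)" for a b
    by simp
  ultimately show ?thesis by (simp only: decidable_def)
qed

lemma decidable_disj [computable_intros]: "decidable P \<Longrightarrow> decidable Q \<Longrightarrow> decidable (\<lambda>x. P x \<or> Q x)"
  and decidable_imp [computable_intros]: "decidable P \<Longrightarrow> decidable Q \<Longrightarrow> decidable (\<lambda>x. P x \<longrightarrow> Q x)"
  using decidable_not [OF decidable_conj [of "\<lambda>x. \<not> P x" "\<lambda>x. \<not> Q x"]]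
    decidable_not [OF decidable_conj [of P "\<lambda>x. \<not> Q x"]] by (simp_all add: decidable_not)

lemma decidable_compare [computable_intros]:
  assumes "computable f" "computable g"
  shows "decidable (\<lambda>x. f x \<le> g x)" "decidable (\<lambda>x. f x < g x)" "decidable (\<lambda>x. f x = g x)"
proof -
  have le: "decidable (\<lambda>x. f x \<le> g x)" if "computable f" "computable g" for f g
  proof -
    have "computable (\<lambda>x. 1 - (f x - g x))" using that by (intro computable_intros)
    moreover have "1 - (u - v) = (if u \<le> v then 1 else 0)" for u v :: nat by auto
    ultimately show ?thesis unfolding decidable_def by simp
  qed
  with assms show "decidable (\<lambda>x. f x \<le> g x)" by blast
  from le [of g f] assms show "decidable (\<lambda>x. f x < g x)"
    using decidable_not [of "\<lambda>x. g x \<le> f x"] by (simp add: not_le)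
  from le [of f g] le [of g f] assms show "decidable (\<lambda>x. f x = g x)"
    using decidable_conj [of "\<lambda>x. f x \<le> g x" "\<lambda>x. g x \<le> f x"] by (simp add: order_eq_iff)
qed

lemma decidable_all_less [computable_intros]:
  assumes "computable b" "decidable (\<lambda>p. P (p1 p) (p2 p))"
  shows "decidable (\<lambda>x. \<forall>i<b x. P i x)"
proof -
  have P: "decidable (\<lambda>x. P (f x) (g x))" if "computable f" "computable g" for f g
    using decidable_comp [OF assms(2), of "\<lambda>x. pr (f x) (g x)"] that
    by (simp add: computable_intros)
  have "computable (\<lambda>x. rec_nat 1 (\<lambda>i r. if P i x then r else 0) (b x))"
    by (intro computable_rec computable_if P) (intro computable_intros assms)+
  moreover have "rec_nat 1 (\<lambda>i r. if P i x then r else 0) n = (if \<forall>i<n. P i x then 1 else 0 :: nat)" for x n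
    by (induction n) (auto simp: less_Suc_eq)
  ultimately show ?thesis unfolding decidable_def by simp
qed

lemma computable_Least:
  assumes "decidable (\<lambda>p. P (p1 p) (p2 p))" "\<And>x. \<exists>k. P k x"
  shows "computable (\<lambda>x. LEAST k. P k x)"
proof -
  have "computable (\<lambda>p. if P (p1 p) (p2 p) then 0 else 1)" using assms(1) by (intro computable_intros)
  from rec_on_computable [OF this, of 2 "\<lambda>ys. pr (ys ! 0) (ys ! 1)"]
  have "rec_on (Suc 1) (\<lambda>ys. if P (ys ! 0) (ys ! 1) then 0 else 1)"
    by (simp add: rec_on_pr rec_on_proj eval_nat_numeral)
  then have "rec_on 1 (\<lambda>xs. LEAST k. (\<lambda>ys. if P (ys ! 0) (ys ! 1) then 0 else 1) (k # xs) = (0 :: nat))"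
    using assms(2) by (intro rec_on_minim) simp_all
  moreover have "((if b then 0 else 1) = (0 :: nat)) = b" for b by simp
  ultimately show ?thesis by (simp add: computable_def)
qed

section \<open>Semidecidable predicates\<close>

definition sigma1 :: "(nat \<Rightarrow> bool) \<Rightarrow> bool" where
  "sigma1 P \<longleftrightarrow> (\<exists>Q. decidable (\<lambda>p. Q (p1 p) (p2 p)) \<and> (\<forall>x. P x \<longleftrightarrow> (\<exists>w. Q w x)))"

text \<open>Decidability of the matrix is restated for arbitrary computable arguments, the form in
  which it joins the introduction rules.\<close>

lemma sigma1E:
  assumes "sigma1 P"
  obtains Q where "\<And>f g. computable f \<Longrightarrow> computable g \<Longrightarrow> decidable (\<lambda>x. Q (f x) (g x))"
    and "\<And>x. P x \<longleftrightarrow> (\<exists>w. Q w x)"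
proof -
  from assms obtain Q where Q: "decidable (\<lambda>p. Q (p1 p) (p2 p))" "\<And>x. P x \<longleftrightarrow> (\<exists>w. Q w x)"
    by (auto simp: sigma1_def)
  have "decidable (\<lambda>x. Q (f x) (g x))" if "computable f" "computable g" for f g
    using decidable_comp [OF Q(1), of "\<lambda>x. pr (f x) (g x)"] that
    by (simp add: computable_intros)
  with Q(2) that show ?thesis by blast
qed

lemma sigma1I:
  "decidable (\<lambda>p. Q (p1 p) (p2 p)) \<Longrightarrow> (\<And>x. P x \<longleftrightarrow> (\<exists>w. Q w x)) \<Longrightarrow> sigma1 P"
  unfolding sigma1_def by blast

lemma sigma1_decidable: "decidable P \<Longrightarrow> sigma1 P"
  by (rule sigma1I [of "\<lambda>w. P"]) (simp_all add: decidable_comp [of P p2] computable_p1_p2)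

lemma sigma1_comp: "sigma1 P \<Longrightarrow> computable f \<Longrightarrow> sigma1 (\<lambda>x. P (f x))"
proof (erule sigma1E)
  fix Q
  assume "computable f" "\<And>f g. computable f \<Longrightarrow> computable g \<Longrightarrow> decidable (\<lambda>x. Q (f x) (g x))"
    "\<And>x. P x \<longleftrightarrow> (\<exists>w. Q w x)"
  then show ?thesis
    by (intro sigma1I [of "\<lambda>w x. Q w (f x)"]) (simp_all add: computable_p1_p2 computable_comp [of f p2])
qed

lemma sigma1_conj [computable_intros]: "sigma1 P \<Longrightarrow> sigma1 P' \<Longrightarrow> sigma1 (\<lambda>x. P x \<and> P' x)"
proof (elim sigma1E)
  fix Q Q'
  assume Q: "\<And>f g. computable f \<Longrightarrow> computable g \<Longrightarrow> decidable (\<lambda>x. Q (f x) (g x))"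
      "\<And>f g. computable f \<Longrightarrow> computable g \<Longrightarrow> decidable (\<lambda>x. Q' (f x) (g x))"
    and P: "\<And>x. P x \<longleftrightarrow> (\<exists>w. Q w x)" "\<And>x. P' x \<longleftrightarrow> (\<exists>w. Q' w x)"
  show ?thesis
  proof (rule sigma1I [of "\<lambda>w x. Q (p1 w) x \<and> Q' (p2 w) x"])
    show "decidable (\<lambda>p. Q (p1 (p1 p)) (p2 p) \<and> Q' (p2 (p1 p)) (p2 p))"
      by (intro computable_intros Q)
    show "P x \<and> P' x \<longleftrightarrow> (\<exists>w. Q (p1 w) x \<and> Q' (p2 w) x)" for x
      unfolding P by (metis p_pr(1,2))
  qed
qed

lemma sigma1_disj [computable_intros]: "sigma1 P \<Longrightarrow> sigma1 P' \<Longrightarrow> sigma1 (\<lambda>x. P x \<or> P' x)"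
proof (elim sigma1E)
  fix Q Q'
  assume Q: "\<And>f g. computable f \<Longrightarrow> computable g \<Longrightarrow> decidable (\<lambda>x. Q (f x) (g x))"
      "\<And>f g. computable f \<Longrightarrow> computable g \<Longrightarrow> decidable (\<lambda>x. Q' (f x) (g x))"
    and P: "\<And>x. P x \<longleftrightarrow> (\<exists>w. Q w x)" "\<And>x. P' x \<longleftrightarrow> (\<exists>w. Q' w x)"
  show ?thesis
  proof (rule sigma1I [of "\<lambda>w x. Q w x \<or> Q' w x"])
    show "decidable (\<lambda>p. Q (p1 p) (p2 p) \<or> Q' (p1 p) (p2 p))" by (intro computable_intros Q)
  qed (auto simp: P)
qed

lemma sigma1_ex [computable_intros]:
  "sigma1 (\<lambda>p. P (p1 p) (p2 p)) \<Longrightarrow> sigma1 (\<lambda>x. \<exists>y. P y x)"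
proof (erule sigma1E)
  fix Q
  assume Q: "\<And>f g. computable f \<Longrightarrow> computable g \<Longrightarrow> decidable (\<lambda>x. Q (f x) (g x))"
    and P: "\<And>x. P (p1 x) (p2 x) \<longleftrightarrow> (\<exists>w. Q w x)"
  show ?thesis
  proof (rule sigma1I [of "\<lambda>w x. Q (p1 w) (pr (p2 w) x)"])
    show "decidable (\<lambda>p. Q (p1 (p1 p)) (pr (p2 (p1 p)) (p2 p)))" by (intro computable_intros Q)
    show "(\<exists>y. P y x) \<longleftrightarrow> (\<exists>w. Q (p1 w) (pr (p2 w) x))" for x
      by (metis P p_pr(1,2))
  qed
qed

text \<open>Every number is read as an infinite sequence of nested pairs, without end marker; the
  length of a finite sequence is kept separately.\<close>

definition ent :: "nat \<Rightarrow> nat \<Rightarrow> nat" where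
  "ent w i = p1 (rec_nat w (\<lambda>_ r. p2 r) i)"

lemma computable_ent [computable_intros]:
  "computable f \<Longrightarrow> computable g \<Longrightarrow> computable (\<lambda>x. ent (f x) (g x))"
  unfolding ent_def by (intro computable_intros)

lemma ent_list: "\<exists>w. \<forall>i<length xs. ent w i = xs ! i"
proof (induction xs)
  case (Cons x xs)
  then obtain w where w: "\<And>i. i < length xs \<Longrightarrow> ent w i = xs ! i" by blast
  have "rec_nat (pr x w) (\<lambda>_ r. p2 r) (Suc i) = rec_nat w (\<lambda>_ r. p2 r) i" for i
    by (induction i) simp_all
  then have "ent (pr x w) (Suc i) = ent w i" for i by (simp only: ent_def)
  moreover have "ent (pr x w) 0 = x" by (simp add: ent_def)
  ultimately have "\<forall>i<length (x # xs). ent (pr x w) i = (x # xs) ! i"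
    using w by (auto simp: less_Suc_eq_0_disj)
  then show ?case ..
qed simp

text \<open>Finitely many witnesses, one for each \<open>i < b x\<close>, are collected into a
  single coded sequence; the bounded quantifier then ranges over a decidable matrix.\<close>

lemma sigma1_all_less [computable_intros]:
  assumes "computable b"
  shows "sigma1 (\<lambda>p. P (p1 p) (p2 p)) \<Longrightarrow> sigma1 (\<lambda>x. \<forall>i<b x. P i x)"
proof (erule sigma1E)
  fix Q
  assume Q: "\<And>f g. computable f \<Longrightarrow> computable g \<Longrightarrow> decidable (\<lambda>x. Q (f x) (g x))"
    and P: "\<And>x. P (p1 x) (p2 x) \<longleftrightarrow> (\<exists>w. Q w x)"
  show ?thesis
  proof (rule sigma1I [of "\<lambda>w x. \<forall>i<b x. Q (ent w i) (pr i x)"])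
    show "decidable (\<lambda>p. \<forall>i<b (p2 p). Q (ent (p1 p) i) (pr i (p2 p)))"
      by (intro computable_intros Q computable_comp [OF assms])
    show "(\<forall>i<b x. P i x) \<longleftrightarrow> (\<exists>w. \<forall>i<b x. Q (ent w i) (pr i x))" for x
    proof
      assume "\<forall>i<b x. P i x"
      then have "\<forall>i<b x. \<exists>w. Q w (pr i x)" using P by (metis p_pr(1,2))
      then obtain g where g: "\<And>i. i < b x \<Longrightarrow> Q (g i) (pr i x)" by metis
      from ent_list [of "map g [0..<b x]"] g show "\<exists>w. \<forall>i<b x. Q (ent w i) (pr i x)"
        by (metis (no_types, lifting) add_0 diff_zero length_map length_upt nth_map_upt)
    qed (metis P p_pr(1,2))
  qed
qed

lemma sigma1_compare [computable_intros]:
  assumes "computable f" "computable g"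
  shows "sigma1 (\<lambda>x. f x = g x)" "sigma1 (\<lambda>x. f x < g x)"
  using assms by (auto intro: sigma1_decidable computable_intros)

text \<open>Search for a witness and a value together: totality of \<open>f\<close> makes the search
  end, and every hit carries the right value.\<close>

lemma computable_graph:
  "sigma1 (\<lambda>p. p2 p = f (p1 p)) \<Longrightarrow> computable f"
proof (erule sigma1E)
  fix Q
  assume Q: "\<And>f g. computable f \<Longrightarrow> computable g \<Longrightarrow> decidable (\<lambda>x. Q (f x) (g x))"
    and f: "\<And>x. p2 x = f (p1 x) \<longleftrightarrow> (\<exists>w. Q w x)"
  let ?m = "\<lambda>x. LEAST m. Q (p1 m) (pr x (p2 m))"
  have ex: "\<exists>m. Q (p1 m) (pr x (p2 m))" for x
    using f [of "pr x (f x)"] by (metis p_pr(1,2))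
  have "computable ?m"
    using ex by (intro computable_Least) (intro computable_intros Q)
  then have "computable (\<lambda>x. p2 (?m x))" by (rule computable_p2)
  moreover have "p2 (?m x) = f x" for x
    using LeastI_ex [OF ex, of x] f [of "pr x (p2 (?m x))"] by auto
  ultimately show ?thesis by simp
qed

section \<open>Inductive definitions are semidecidable\<close>

text \<open>Judgements are numbers. Two premises are what the application case of a structural
  recursion takes; a rule with one premise is applied with that premise given twice.\<close>

inductive derivable :: "(nat \<Rightarrow> bool) \<Rightarrow> (nat \<Rightarrow> nat \<Rightarrow> nat \<Rightarrow> bool) \<Rightarrow> nat \<Rightarrow> bool" for A B where
  axiom: "A j \<Longrightarrow> derivable A B j"
| rule: "B j j1 j2 \<Longrightarrow> derivable A B j1 \<Longrightarrow> derivable A B j2 \<Longrightarrow> derivable A B j"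

text \<open>Derivation trees flattened into lists: the conclusion comes first and premises stand to
  its right, so that two derivations can be concatenated.\<close>

primrec derivation :: "(nat \<Rightarrow> bool) \<Rightarrow> (nat \<Rightarrow> nat \<Rightarrow> nat \<Rightarrow> bool) \<Rightarrow> nat list \<Rightarrow> bool" where
  "derivation A B [] = True"
| "derivation A B (j # L) \<longleftrightarrow> derivation A B L \<and> (A j \<or> (\<exists>j1\<in>set L. \<exists>j2\<in>set L. B j j1 j2))"

lemma derivation_append: "derivation A B L \<Longrightarrow> derivation A B M \<Longrightarrow> derivation A B (L @ M)"
  by (induction L) auto

lemma derivable_derivation: "derivable A B j \<Longrightarrow> \<exists>L. derivation A B (j # L)"
proof (induction rule: derivable.induct)
  case (axiom j)
  then show ?case by (auto intro: exI [of _ "[]"])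
next
  case (rule j j1 j2)
  then obtain L1 L2 where "derivation A B (j1 # L1)" "derivation A B (j2 # L2)" by blast
  then have "derivation A B ((j1 # L1) @ (j2 # L2))" by (rule derivation_append)
  with rule.hyps(1) have "derivation A B (j # (j1 # L1) @ (j2 # L2))" by auto
  then show ?case ..
qed

lemma derivation_nth:
  "derivation A B L \<Longrightarrow> i < length L \<Longrightarrow>
   A (L ! i) \<or> (\<exists>k1 k2. i < k1 \<and> k1 < length L \<and> i < k2 \<and> k2 < length L \<and> B (L ! i) (L ! k1) (L ! k2))"
proof (induction L arbitrary: i)
  case (Cons j L)
  let ?R = "\<lambda>M i. A (M ! i) \<or> (\<exists>k1 k2. i < k1 \<and> k1 < length M \<and> i < k2 \<and> k2 < length M \<and>
    B (M ! i) (M ! k1) (M ! k2))"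
  show ?case
  proof (cases i)
    case 0
    from Cons.prems(1) consider "A j" | j1 j2 where "j1 \<in> set L" "j2 \<in> set L" "B j j1 j2" by auto
    then show ?thesis
    proof cases
      case 2
      then obtain m1 m2 where "m1 < length L" "j1 = L ! m1" "m2 < length L" "j2 = L ! m2"
        by (metis in_set_conv_nth)
      with 2 0 have "i < Suc m1 \<and> Suc m1 < length (j # L) \<and> i < Suc m2 \<and> Suc m2 < length (j # L) \<and>
        B ((j # L) ! i) ((j # L) ! Suc m1) ((j # L) ! Suc m2)" by simp
      then show ?thesis by blast
    qed (use 0 in simp)
  next
    case (Suc i')
    with Cons.IH [of i'] Cons.prems have "?R L i'" by simp
    then show ?thesis
    proof (elim disjE exE conjE)
      fix k1 k2
      assume "i' < k1" "k1 < length L" "i' < k2" "k2 < length L" "B (L ! i') (L ! k1) (L ! k2)"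
      with Suc have "i < Suc k1 \<and> Suc k1 < length (j # L) \<and> i < Suc k2 \<and> Suc k2 < length (j # L) \<and>
        B ((j # L) ! i) ((j # L) ! Suc k1) ((j # L) ! Suc k2)" by simp
      then show ?thesis by blast
    qed (use Suc in simp)
  qed
qed simp

text \<open>A derivation becomes a coded sequence \<open>w\<close> of length \<open>n\<close> in
  which premises have larger indices; apart from \<open>w\<close> and \<open>n\<close> all
  quantifiers are bounded. Conversely, entries are derivable by induction on
  \<open>n - i\<close>.\<close>

lemma derivable_iff:
  "derivable A B j \<longleftrightarrow> (\<exists>w n. j = ent w 0 \<and> 0 < n \<and> (\<forall>i<n. A (ent w i) \<or>
     (\<exists>k1 k2. i < k1 \<and> k1 < n \<and> i < k2 \<and> k2 < n \<and> B (ent w i) (ent w k1) (ent w k2))))"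
    (is "_ \<longleftrightarrow> (\<exists>w n. ?D w n)")
proof
  assume "derivable A B j"
  then obtain L where L: "derivation A B (j # L)" using derivable_derivation by blast
  obtain w where "\<forall>i<length (j # L). ent w i = (j # L) ! i" using ent_list by blast
  moreover from this have "ent w 0 = j" by force
  ultimately have "?D w (length (j # L))"
    using derivation_nth [OF L] by (metis length_greater_0_conv list.distinct(1))
  then show "\<exists>w n. ?D w n" by blast
next
  assume "\<exists>w n. ?D w n"
  then obtain w n where j: "j = ent w 0" "0 < n" and D: "\<And>i. i < n \<Longrightarrow> A (ent w i) \<or>
     (\<exists>k1 k2. i < k1 \<and> k1 < n \<and> i < k2 \<and> k2 < n \<and> B (ent w i) (ent w k1) (ent w k2))" by blast
  have "derivable A B (ent w i)" if "i < n" for i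
    using that
  proof (induction "n - i" arbitrary: i rule: less_induct)
    case less
    from D [OF less.prems] show ?case
    proof (elim disjE exE conjE)
      fix k1 k2
      assume "i < k1" "k1 < n" "i < k2" "k2 < n" "B (ent w i) (ent w k1) (ent w k2)"
      moreover from this have "derivable A B (ent w k1)" "derivable A B (ent w k2)"
        by (auto intro!: less.hyps)
      ultimately show ?thesis by (blast intro: derivable.rule)
    qed (rule derivable.axiom)
  qed
  with j show "derivable A B j" by simp
qed

lemma sigma1_derivable:
  assumes A: "sigma1 A" and B: "sigma1 (\<lambda>x. B (p1 x) (p1 (p2 x)) (p2 (p2 x)))"
  shows "sigma1 (derivable A B)"
proof -
  have A': "sigma1 (\<lambda>x. A (f x))" if "computable f" for f
    using sigma1_comp [OF A that] .
  have B': "sigma1 (\<lambda>x. B (f x) (g x) (h x))" if "computable f" "computable g" "computable h" for f g h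
    using sigma1_comp [OF B, of "\<lambda>x. pr (f x) (pr (g x) (h x))"] that
    by (simp add: computable_intros)
  show ?thesis
    unfolding derivable_iff [abs_def] by (intro computable_intros A' B')
qed

section \<open>Arithmetization of terms and reduction\<close>

section \<open>Computing with term codes\<close>

abbreviation code :: "tm \<Rightarrow> nat" where "code \<equiv> term_code"

definition dec :: "nat \<Rightarrow> tm" where "dec = inv term_code"

lemma dec_code [simp]: "dec (code t) = t"
  and code_dec [simp]: "code (dec n) = n"
  unfolding dec_def using bij_term_code by (simp_all add: bij_is_inj bij_is_surj surj_f_inv_f)

lemma code_simps [simp]:
  "code (App s t) = Suc (3 * pr (code s) (code t))" "code (Lam t) = Suc (Suc (3 * code t))"
  by (simp_all add: pr_def)

declare term_code.simps(2,3) [simp del]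

lemma dec_simps [simp]:
  "dec (3 * i) = Var i" "dec (Suc (3 * n)) = App (dec (p1 n)) (dec (p2 n))"
  "dec (Suc (Suc (3 * n))) = Lam (dec n)"
  using dec_code [of "Var i"] dec_code [of "App (dec (p1 n)) (dec (p2 n))"] dec_code [of "Lam (dec n)"]
  by (simp_all del: dec_code)

definition kind :: "nat \<Rightarrow> nat" where "kind c = c mod 3"
definition arg :: "nat \<Rightarrow> nat" where "arg c = c div 3"

lemma kind_arg [simp]:
  "kind (3 * n) = 0" "kind (Suc (3 * n)) = 1" "kind (Suc (Suc (3 * n))) = 2"
  "arg (3 * n) = n" "arg (Suc (3 * n)) = n" "arg (Suc (Suc (3 * n))) = n"
  unfolding kind_def arg_def by presburger+

lemma kind_code:
  "kind (code t) = 0 \<longleftrightarrow> (\<exists>i. t = Var i)"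
  "kind (code t) = 1 \<longleftrightarrow> (\<exists>s u. t = App s u)"
  "kind (code t) = 2 \<longleftrightarrow> (\<exists>u. t = Lam u)"
  by (cases t; simp)+

lemma computable_arg [computable_intros]: "computable f \<Longrightarrow> computable (\<lambda>x. arg (f x))"
proof -
  have "arg c = (LEAST q. c < 3 * Suc q)" for c
    unfolding arg_def by (rule Least_equality [symmetric]) presburger+
  moreover have "computable (\<lambda>c. LEAST q. c < 3 * Suc q)"
    by (rule computable_Least, intro computable_intros) presburger
  ultimately have "computable arg" by presburger
  then show "computable f \<Longrightarrow> ?thesis" by (rule computable_comp)
qed

lemma computable_kind [computable_intros]: "computable f \<Longrightarrow> computable (\<lambda>x. kind (f x))"
proof -
  have "kind c = c - 3 * arg c" for c unfolding kind_def arg_def by presburger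
  then show "computable f \<Longrightarrow> ?thesis" by (simp add: computable_intros)
qed

text \<open>Structural recursion with a parameter that may change in the recursive calls: the graph is
  semidecidable, as it is given by derivations of judgements \<open>pr (pr (code t) p) (h t p)\<close>.\<close>

theorem computable_struct_rec:
  fixes h :: "tm \<Rightarrow> nat \<Rightarrow> nat"
  assumes h: "\<And>i p. h (Var i) p = v i p"
      "\<And>s t p. h (App s t) p = a (code s) (code t) p (h s (\<sigma> p)) (h t (\<tau> p))"
      "\<And>t p. h (Lam t) p = l (code t) p (h t (\<rho> p))"
    and v: "\<And>f g. computable f \<Longrightarrow> computable g \<Longrightarrow> computable (\<lambda>x. v (f x) (g x))"
    and a: "\<And>c d f g k. computable c \<Longrightarrow> computable d \<Longrightarrow> computable f \<Longrightarrow> computable g \<Longrightarrow> computable k \<Longrightarrow>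
      computable (\<lambda>x. a (c x) (d x) (f x) (g x) (k x))"
    and l: "\<And>c f g. computable c \<Longrightarrow> computable f \<Longrightarrow> computable g \<Longrightarrow>
      computable (\<lambda>x. l (c x) (f x) (g x))"
    and \<sigma>: "\<And>f. computable f \<Longrightarrow> computable (\<lambda>x. \<sigma> (f x))"
    and \<tau>: "\<And>f. computable f \<Longrightarrow> computable (\<lambda>x. \<tau> (f x))"
    and \<rho>: "\<And>f. computable f \<Longrightarrow> computable (\<lambda>x. \<rho> (f x))"
    and fg: "computable f" "computable g"
  shows "computable (\<lambda>x. h (dec (f x)) (g x))"
proof -
  \<comment> \<open>In a judgement \<open>j\<close>, \<open>p1 (p1 j)\<close> codes the term,
    \<open>p2 (p1 j)\<close> is the parameter and \<open>p2 j\<close> the claimed value.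
    \<open>A\<close> settles variables, \<open>B\<close> the other two constructors.\<close>
  define A where "A j \<longleftrightarrow> kind (p1 (p1 j)) = 0 \<and> p2 j = v (arg (p1 (p1 j))) (p2 (p1 j))" for j
  define B where "B j j1 j2 \<longleftrightarrow>
     (kind (p1 (p1 j)) = 1 \<and> p1 j1 = pr (p1 (arg (p1 (p1 j)))) (\<sigma> (p2 (p1 j))) \<and>
       p1 j2 = pr (p2 (arg (p1 (p1 j)))) (\<tau> (p2 (p1 j))) \<and>
       p2 j = a (p1 (arg (p1 (p1 j)))) (p2 (arg (p1 (p1 j)))) (p2 (p1 j)) (p2 j1) (p2 j2)) \<or>
     (kind (p1 (p1 j)) = 2 \<and> p1 j1 = pr (arg (p1 (p1 j))) (\<rho> (p2 (p1 j))) \<and>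
       p2 j = l (arg (p1 (p1 j))) (p2 (p1 j)) (p2 j1))" for j j1 j2
  let ?H = "\<lambda>x. h (dec (p1 x)) (p2 x)"
  have "sigma1 (derivable A B)"
    unfolding A_def B_def by (intro sigma1_derivable computable_intros v a l \<sigma> \<tau> \<rho>)
  moreover have "derivable A B j \<longleftrightarrow> p2 j = ?H (p1 j)" for j
  proof
    show "p2 j = ?H (p1 j)" if "derivable A B j"
      using that
    proof (induction rule: derivable.induct)
      case (axiom j)
      then show ?case using kind_code(1) [of "dec (p1 (p1 j))"]
        by (auto simp: A_def h) (metis code_dec kind_arg(4) term_code.simps(1))
    next
      case (rule j j1 j2)
      obtain t where t: "p1 (p1 j) = code t" by (metis code_dec)
      show ?case
      proof (cases t)
        case (Var i)
        with rule.hyps(1) t show ?thesis by (simp add: B_def)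
      next
        case (App s u)
        with rule t show ?thesis by (simp add: B_def h del: One_nat_def)
      next
        case (Lam s)
        with rule t show ?thesis by (simp add: B_def h)
      qed
    qed
  next
    have "derivable A B (pr (pr (code t) p) (h t p))" for t p
    proof (induction t arbitrary: p)
      case (Var i)
      show ?case by (rule derivable.axiom) (simp add: A_def h)
    next
      case (App s t)
      show ?case by (rule derivable.rule [OF _ App.IH(1) [of "\<sigma> p"] App.IH(2) [of "\<tau> p"]]) (simp add: B_def h)
    next
      case (Lam t)
      \<comment> \<open>An abstraction has one subterm, so its judgement is used for both
        premises.\<close>
      show ?case by (rule derivable.rule [OF _ Lam.IH [of "\<rho> p"] Lam.IH [of "\<rho> p"]]) (simp add: B_def h)
    qed
    from this [of "dec (p1 (p1 j))" "p2 (p1 j)"]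
    have "derivable A B (pr (p1 j) (?H (p1 j)))" by simp
    then show "derivable A B j" if "p2 j = ?H (p1 j)" by (metis p_pr(3) that)
  qed
  ultimately have "sigma1 (\<lambda>j. p2 j = ?H (p1 j))"
    by (rule back_subst [where P = sigma1, OF _ ext])
  then have "computable ?H" by (rule computable_graph)
  from computable_comp [OF this, of "\<lambda>x. pr (f x) (g x)"] show ?thesis
    using fg by (simp add: computable_intros)
qed

lemma computable_lift [computable_intros]:
  "computable f \<Longrightarrow> computable g \<Longrightarrow> computable (\<lambda>x. code (lift (dec (f x)) (g x)))"
  by (rule computable_struct_rec [where h = "\<lambda>t k. code (lift t k)" and
        v = "\<lambda>i k. if i < k then 3 * i else 3 * Suc i" and a = "\<lambda>_ _ _ r r'. Suc (3 * pr r r')" and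
        l = "\<lambda>_ _ r. Suc (Suc (3 * r))" and \<sigma> = "\<lambda>k. k" and \<tau> = "\<lambda>k. k" and \<rho> = Suc])
    (simp, simp, simp, (intro computable_intros | assumption)+)

lemma computable_subst [computable_intros]:
  assumes "computable f" "computable g" "computable k"
  shows "computable (\<lambda>x. code (subst (dec (f x)) (dec (g x)) (k x)))"
proof -
  \<comment> \<open>Substituted term and index both change under a binder, so they travel together
    in the parameter.\<close>
  let ?h = "\<lambda>t p. code (subst t (dec (p1 p)) (p2 p))"
  have "computable (\<lambda>x. ?h (dec (f x)) (pr (g x) (k x)))"
    by (rule computable_struct_rec [where h = ?h and
        v = "\<lambda>i p. if p2 p < i then 3 * (i - 1) else if i = p2 p then p1 p else 3 * i" and
        a = "\<lambda>_ _ _ r r'. Suc (3 * pr r r')" and l = "\<lambda>_ _ r. Suc (Suc (3 * r))" and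
        \<sigma> = "\<lambda>p. p" and \<tau> = "\<lambda>p. p" and \<rho> = "\<lambda>p. pr (code (lift (dec (p1 p)) 0)) (Suc (p2 p))"])
      (simp, simp, simp, (intro computable_intros assms | assumption)+)
  then show ?thesis by simp
qed

text \<open>A term serves as a context with several holes: the variable \<open>0\<close> is the hole, and
  \<open>Var (Suc i)\<close> stands for \<open>Var i\<close>.\<close>

primrec mfill :: "tm \<Rightarrow> tm \<Rightarrow> tm" where
  "mfill (Var i) M = (if i = 0 then M else Var (i - 1))"
| "mfill (App C D) M = App (mfill C M) (mfill D M)"
| "mfill (Lam C) M = Lam (mfill C M)"

lemma computable_mfill [computable_intros]:
  "computable f \<Longrightarrow> computable g \<Longrightarrow> computable (\<lambda>x. code (mfill (dec (f x)) (dec (g x))))"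
  by (rule computable_struct_rec [where h = "\<lambda>t p. code (mfill t (dec p))" and
        v = "\<lambda>i p. if i = 0 then p else 3 * (i - 1)" and a = "\<lambda>_ _ _ r r'. Suc (3 * pr r r')" and
        l = "\<lambda>_ _ r. Suc (Suc (3 * r))" and \<sigma> = "\<lambda>p. p" and \<tau> = "\<lambda>p. p" and \<rho> = "\<lambda>p. p"])
    (simp, simp, simp, (intro computable_intros | assumption)+)

lemma beta_simps:
  "\<not> beta (Var i) u"
  "beta (Lam t) u \<longleftrightarrow> (\<exists>u'. u = Lam u' \<and> beta t u')"
  "beta (App s t) u \<longleftrightarrow> (\<exists>b. s = Lam b \<and> u = subst b t 0) \<or>
    (\<exists>s' t'. u = App s' t' \<and> (beta s s' \<and> t' = t \<or> s' = s \<and> beta t t'))"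
  by (auto elim: beta.cases intro: beta.intros)

text \<open>Structural recursion on the source with the code of the target as parameter. Components
  of the target are passed down whatever its constructor is; the tests of \<open>kind p\<close>
  discard answers that make no sense.\<close>

lemma decidable_beta [computable_intros]:
  assumes "computable f" "computable g"
  shows "decidable (\<lambda>x. beta (dec (f x)) (dec (g x)))"
  unfolding decidable_def
proof (rule computable_struct_rec [where h = "\<lambda>t p. if beta t (dec p) then 1 else 0" and
      v = "\<lambda>_ _. 0" and \<sigma> = "\<lambda>p. p1 (arg p)" and \<tau> = "\<lambda>p. p2 (arg p)" and \<rho> = arg and
      a = "\<lambda>c d p r r'. if (kind c = 2 \<and> p = code (subst (dec (arg c)) (dec d) 0)) \<or>
        (kind p = 1 \<and> (r = 1 \<and> p2 (arg p) = d \<or> p1 (arg p) = c \<and> r' = 1)) then 1 else 0" and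
      l = "\<lambda>_ p r. if kind p = 2 \<and> r = 1 then 1 else 0"])
  fix s t p
  show "(if beta (Var i) (dec p) then 1 else 0) = (0 :: nat)" for i
    by (simp add: beta_simps)
  obtain u where p: "p = code u" by (metis code_dec)
  then have u: "dec p = u" by simp
  have *: "kind (code s) = 2 \<and> p = code (subst (dec (arg (code s))) t 0) \<longleftrightarrow>
      (\<exists>b. s = Lam b \<and> u = subst b t 0)"
    unfolding kind_code p by (metis code_simps(2) dec_code kind_arg(6))
  have **: "kind p = 1 \<and> (beta s (dec (p1 (arg p))) \<and> p2 (arg p) = code t \<or>
        p1 (arg p) = code s \<and> beta t (dec (p2 (arg p)))) \<longleftrightarrow>
      (\<exists>s' t'. u = App s' t' \<and> (beta s s' \<and> t' = t \<or> s' = s \<and> beta t t'))"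
    unfolding p by (cases u) (auto dest: arg_cong [of _ _ dec])
  have [simp]: "((if b then 1 else 0) = (1 :: nat)) = b" for b by simp
  show "(if beta (App s t) (dec p) then 1 else 0) = (if (kind (code s) = 2 \<and>
      p = code (subst (dec (arg (code s))) (dec (code t)) 0)) \<or> (kind p = 1 \<and>
      ((if beta s (dec (p1 (arg p))) then 1 else 0) = (1 :: nat) \<and> p2 (arg p) = code t \<or>
       p1 (arg p) = code s \<and> (if beta t (dec (p2 (arg p))) then 1 else 0) = (1 :: nat))) then 1 else 0 :: nat)"
    by (simp only: u beta_simps dec_code * ** \<open>\<And>b. ((if b then 1 else 0) = (1 :: nat)) = b\<close>)
  show "(if beta (Lam t) (dec p) then 1 else 0) = (if kind p = 2 \<and>
      (if beta t (dec (arg p)) then 1 else 0) = (1 :: nat) then 1 else 0 :: nat)"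
    unfolding beta_simps p by (cases u) auto
qed (intro computable_intros assms | assumption)+

section \<open>Deciding the three kinds of normal form\<close>

definition is_neutral :: "tm \<Rightarrow> bool" where
  "is_neutral t \<longleftrightarrow> (\<exists>x Ms. t = neutral x Ms)"

lemma is_neutral_simps [simp]:
  "is_neutral (Var x)" "\<not> is_neutral (Lam t)" "is_neutral (App s t) \<longleftrightarrow> is_neutral s"
proof -
  show "is_neutral (Var x)" unfolding is_neutral_def by (metis foldl_Nil)
  show "is_neutral (App s t) \<longleftrightarrow> is_neutral s"
  proof
    assume "is_neutral (App s t)"
    then obtain x Ms where "App s t = neutral x Ms" by (auto simp: is_neutral_def)
    then show "is_neutral s" by (cases Ms rule: rev_cases) (auto simp: is_neutral_def)
  next
    assume "is_neutral s"
    then obtain x Ms where "s = neutral x Ms" by (auto simp: is_neutral_def)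
    then have "App s t = neutral x (Ms @ [t])" by simp
    then show "is_neutral (App s t)" unfolding is_neutral_def by blast
  qed
qed (simp add: is_neutral_def)

lemma is_whnf_iff: "is_whnf t \<longleftrightarrow> is_neutral t \<or> (\<exists>u. t = Lam u)"
  by (simp add: is_whnf_def is_neutral_def)

lemma is_hnf_iff: "is_hnf t \<longleftrightarrow> (\<exists>n u. t = (Lam ^^ n) u \<and> is_neutral u)"
  by (auto simp: is_hnf_def is_neutral_def)

lemma is_hnf_simps [simp]:
  "is_hnf (Var x)" "is_hnf (Lam t) \<longleftrightarrow> is_hnf t" "is_hnf (App s t) \<longleftrightarrow> is_neutral s"
proof -
  have *: "is_hnf t \<longleftrightarrow> is_neutral t \<or> (\<exists>u. t = Lam u \<and> is_hnf u)" for t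
  proof
    assume "is_hnf t"
    then obtain n u where "t = (Lam ^^ n) u" "is_neutral u" by (auto simp: is_hnf_iff)
    then show "is_neutral t \<or> (\<exists>u. t = Lam u \<and> is_hnf u)" by (cases n) (auto simp: is_hnf_iff)
  next
    assume "is_neutral t \<or> (\<exists>u. t = Lam u \<and> is_hnf u)"
    then show "is_hnf t" unfolding is_hnf_iff by (metis funpow_0 funpow.simps(2) comp_apply)
  qed
  show "is_hnf (Var x)" "is_hnf (Lam t) \<longleftrightarrow> is_hnf t" "is_hnf (App s t) \<longleftrightarrow> is_neutral s"
    by (subst *; simp)+
qed

lemma decidable_neutral [computable_intros]:
  assumes "computable f"
  shows "decidable (\<lambda>x. is_neutral (dec (f x)))"
  unfolding decidable_def
  by (rule computable_struct_rec [where h = "\<lambda>t _. if is_neutral t then 1 else 0" and g = "\<lambda>x. x" and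
      v = "\<lambda>_ _. 1" and \<sigma> = "\<lambda>p. p" and \<tau> = "\<lambda>p. p" and \<rho> = "\<lambda>p. p" and
      a = "\<lambda>_ _ _ r _. r" and l = "\<lambda>_ _ _. 0"])
    (simp, simp, simp, (intro computable_intros assms | assumption)+)

lemma decidable_whnf: "computable f \<Longrightarrow> decidable (\<lambda>x. is_whnf (dec (f x)))"
proof -
  have "is_whnf (dec c) \<longleftrightarrow> is_neutral (dec c) \<or> kind c = 2" for c
    using kind_code(3) [of "dec c"] by (simp add: is_whnf_iff)
  then show "computable f \<Longrightarrow> ?thesis" by (simp add: computable_intros)
qed

lemma decidable_hnf: "computable f \<Longrightarrow> decidable (\<lambda>x. is_hnf (dec (f x)))"
  unfolding decidable_def
  by (rule computable_struct_rec [where h = "\<lambda>t _. if is_hnf t then 1 else 0" and g = "\<lambda>x. x" and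
      v = "\<lambda>_ _. 1" and \<sigma> = "\<lambda>p. p" and \<tau> = "\<lambda>p. p" and \<rho> = "\<lambda>p. p" and
      a = "\<lambda>c _ _ _ _. if is_neutral (dec c) then 1 else 0" and l = "\<lambda>_ _ r. r"])
    (simp, simp, simp, (intro computable_intros | assumption)+)

lemma decidable_nf: "computable f \<Longrightarrow> decidable (\<lambda>x. is_nf (dec (f x)))"
  unfolding decidable_def
  by (rule computable_struct_rec [where h = "\<lambda>t _. if is_nf t then 1 else 0" and g = "\<lambda>x. x" and
      v = "\<lambda>_ _. 1" and \<sigma> = "\<lambda>p. p" and \<tau> = "\<lambda>p. p" and \<rho> = "\<lambda>p. p" and
      a = "\<lambda>c _ _ r r'. if r = 1 \<and> r' = 1 \<and> kind c \<noteq> 2 then 1 else 0" and l = "\<lambda>_ _ r. r"])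
    (simp, simp add: kind_code del: code_simps, simp, (intro computable_intros | assumption)+)

section \<open>The two halves of completeness\<close>

section \<open>Upper bound\<close>

text \<open>Reducibility into \<open>P\<close> is a derivability: terms in \<open>P\<close> are
  axioms, and a term follows from any of its beta reducts.\<close>

lemma sigma1_reduces_into:
  assumes P: "\<And>f. computable f \<Longrightarrow> decidable (\<lambda>x. P (dec (f x)))"
  shows "sigma1 (\<lambda>c. reduces_into P (dec c))"
proof -
  let ?A = "\<lambda>c. P (dec c)" and ?B = "\<lambda>c d (_ :: nat). beta (dec c) (dec d)"
  have "sigma1 (derivable ?A ?B)"
    by (intro sigma1_derivable sigma1_decidable P computable_intros)
  moreover have "derivable ?A ?B c \<longleftrightarrow> reduces_into P (dec c)" for c
  proof
    show "reduces_into P (dec c)" if "derivable ?A ?B c"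
      using that
    proof (induction rule: derivable.induct)
      case (rule c d e)
      then obtain u where "beta (dec c) (dec d)" "beta\<^sup>*\<^sup>* (dec d) u" "P u"
        unfolding reduces_into_def by blast
      then show ?case
        unfolding reduces_into_def by (blast intro: converse_rtranclp_into_rtranclp)
    qed (auto simp: reduces_into_def)
  next
    assume "reduces_into P (dec c)"
    then obtain u where "beta\<^sup>*\<^sup>* (dec c) u" and u: "P u" by (auto simp: reduces_into_def)
    then have "derivable ?A ?B (code (dec c))"
    proof (induction rule: converse_rtranclp_induct)
      case base
      then show ?case by (auto intro: derivable.axiom)
    next
      case (step t t')
      then show ?case by (intro derivable.rule [of ?B "code t" "code t'" "code t'"]) simp_all
    qed
    then show "derivable ?A ?B c" by simp
  qed
  ultimately show ?thesis by (rule back_subst [where P = sigma1, OF _ ext])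
qed

text \<open>Prenexing: a witness of the premise turns into a universal quantifier, so
  \<open>y\<close> is made to code the original \<open>y\<close> with such a witness, while
  \<open>z\<close> is a witness of the conclusion.\<close>

lemma pi02_all_imp:
  assumes "sigma1 (\<lambda>p. P (p1 p) (p2 p))" "sigma1 (\<lambda>p. P' (p1 p) (p2 p))"
  shows "pi02 {x. \<forall>y. P x y \<longrightarrow> P' x y}"
  using assms
proof (elim sigma1E)
  fix Q Q'
  assume Q: "\<And>f g. computable f \<Longrightarrow> computable g \<Longrightarrow> decidable (\<lambda>x. Q (f x) (g x))"
      "\<And>f g. computable f \<Longrightarrow> computable g \<Longrightarrow> decidable (\<lambda>x. Q' (f x) (g x))"
    and P: "\<And>x. P (p1 x) (p2 x) \<longleftrightarrow> (\<exists>w. Q w x)" "\<And>x. P' (p1 x) (p2 x) \<longleftrightarrow> (\<exists>w. Q' w x)"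
  define R where "R x y z \<longleftrightarrow> (Q (p2 y) (pr x (p1 y)) \<longrightarrow> Q' z (pr x (p1 y)))" for x y z
  have "computable (\<lambda>p. if R (p1 p) (p1 (p2 p)) (p2 (p2 p)) then 1 else 0)"
    unfolding R_def by (intro computable_intros Q)
  from rec_on_computable [OF this, of 3 "\<lambda>ys. pr (ys ! 0) (pr (ys ! 1) (ys ! 2))"]
  have "rec_on 3 (\<lambda>ys. if R (ys ! 0) (ys ! 1) (ys ! 2) then 1 else 0)"
    by (simp add: rec_on_pr rec_on_proj)
  then obtain f where f: "recursive_fun 3 f"
    "\<And>ys. length ys = 3 \<Longrightarrow> f ys = (if R (ys ! 0) (ys ! 1) (ys ! 2) then 1 else 0)"
    unfolding rec_on_def by blast
  have "f [x, y, z] = (if R x y z then 1 else 0)" for x y z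
    using f(2) [of "[x, y, z]"] by simp
  moreover have "(\<forall>y. P x y \<longrightarrow> P' x y) \<longleftrightarrow> (\<forall>y. \<exists>z. R x y z)" for x
  proof -
    have "P x y \<longleftrightarrow> (\<exists>w. Q w (pr x y))" "P' x y \<longleftrightarrow> (\<exists>w. Q' w (pr x y))" for y
      using P [of "pr x y"] by simp_all
    then show ?thesis unfolding R_def by (metis p_pr(1,2))
  qed
  ultimately show ?thesis unfolding pi02_def using f(1) by blast
qed

primrec comp_ctxt :: "ctxt \<Rightarrow> ctxt \<Rightarrow> ctxt" where
  "comp_ctxt Hole E = E"
| "comp_ctxt (AppL C t) E = AppL (comp_ctxt C E) t"
| "comp_ctxt (AppR t C) E = AppR t (comp_ctxt C E)"
| "comp_ctxt (LamC C) E = LamC (comp_ctxt C E)"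

lemma fill_comp_ctxt [simp]: "fill (comp_ctxt C E) M = fill C (fill E M)"
  by (induction C) auto

lemma mfill_const: "\<exists>C. \<forall>M. mfill C M = t"
proof (induction t)
  case (Var i)
  show ?case by (intro exI [of _ "Var (Suc i)"]) simp
next
  case (App s t)
  then obtain C D where "\<And>M. mfill C M = s" "\<And>M. mfill D M = t" by blast
  then show ?case by (intro exI [of _ "App C D"]) simp
next
  case (Lam t)
  then obtain C where "\<And>M. mfill C M = t" by blast
  then show ?case by (intro exI [of _ "Lam C"]) simp
qed

lemma fill_mfill: "\<exists>D. \<forall>M. fill C M = mfill D M"
proof (induction C)
  case Hole
  show ?case by (intro exI [of _ "Var 0"]) simp
next
  case (AppL C t)
  with mfill_const [of t] obtain D E where "\<And>M. fill C M = mfill D M" "\<And>M. mfill E M = t" by blast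
  then show ?case by (intro exI [of _ "App D E"]) simp
next
  case (AppR t C)
  with mfill_const [of t] obtain D E where "\<And>M. fill C M = mfill D M" "\<And>M. mfill E M = t" by blast
  then show ?case by (intro exI [of _ "App E D"]) simp
next
  case (LamC C)
  then obtain D where "\<And>M. fill C M = mfill D M" by blast
  then show ?case by (intro exI [of _ "Lam D"]) simp
qed

text \<open>Holes are replaced part by part, the surrounding one-hole context \<open>D\<close>
  growing along the way. Quantifying over contexts thereby becomes quantifying over terms, for which
  codes exist already.\<close>

lemma obs_eq_iff_mfill:
  "obs_eq P M N \<longleftrightarrow> (\<forall>C. reduces_into P (mfill C M) \<longleftrightarrow> reduces_into P (mfill C N))"
proof
  assume eq: "obs_eq P M N"
  have "reduces_into P (fill D (mfill C M)) \<longleftrightarrow> reduces_into P (fill D (mfill C N))" for C D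
  proof (induction C arbitrary: D)
    case (Var i)
    then show ?case using eq by (simp add: obs_eq_def)
  next
    case (App C1 C2)
    have "reduces_into P (fill D (App (mfill C1 M) (mfill C2 M))) \<longleftrightarrow>
        reduces_into P (fill D (App (mfill C1 N) (mfill C2 M)))"
      using App.IH(1) [of "comp_ctxt D (AppL Hole (mfill C2 M))"] by simp
    also have "\<dots> \<longleftrightarrow> reduces_into P (fill D (App (mfill C1 N) (mfill C2 N)))"
      using App.IH(2) [of "comp_ctxt D (AppR (mfill C1 N) Hole)"] by simp
    finally show ?case by simp
  next
    case (Lam C)
    then show ?case using Lam.IH [of "comp_ctxt D (LamC Hole)"] by simp
  qed
  from this [of Hole] show "\<forall>C. reduces_into P (mfill C M) \<longleftrightarrow> reduces_into P (mfill C N)" by simp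
next
  assume "\<forall>C. reduces_into P (mfill C M) \<longleftrightarrow> reduces_into P (mfill C N)"
  then show "obs_eq P M N" unfolding obs_eq_def by (metis fill_mfill)
qed

lemma decision_problem_iff: "x \<in> decision_problem R \<longleftrightarrow> R (dec (p1 x)) (dec (p2 x))"
proof
  show "R (dec (p1 x)) (dec (p2 x))" if "x \<in> decision_problem R"
    using that by (auto simp: decision_problem_def simp flip: pr_def)
  show "x \<in> decision_problem R" if "R (dec (p1 x)) (dec (p2 x))"
    unfolding decision_problem_def pr_def [symmetric]
    by (intro CollectI exI [of _ "dec (p1 x)"] exI [of _ "dec (p2 x)"]) (simp add: that)
qed

theorem pi02_obs_eq:
  assumes P: "\<And>f. computable f \<Longrightarrow> decidable (\<lambda>x. P (dec (f x)))"
  shows "pi02 (decision_problem (obs_eq P))"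
proof -
  \<comment> \<open>The detour through \<open>dec\<close> and \<open>code\<close> displays
    \<open>S\<close> as a predicate on codes composed with a computable function.\<close>
  define S where "S C c \<longleftrightarrow> reduces_into P (dec (code (mfill (dec C) (dec c))))" for C c
  have red: "sigma1 (\<lambda>c. reduces_into P (dec c))" using P by (rule sigma1_reduces_into)
  have S: "sigma1 (\<lambda>x. S (f x) (g x))" if "computable f" "computable g" for f g
    unfolding S_def using that
    by (intro sigma1_comp [OF red] computable_intros)
  \<comment> \<open>\<open>y\<close> codes a direction together with a context: the equivalence is
    split into two implications, selected by \<open>p1 y = 0\<close>.\<close>
  have "pi02 {x. \<forall>y. S (p2 y) (if p1 y = 0 then p1 x else p2 x) \<longrightarrow>
      S (p2 y) (if p1 y = 0 then p2 x else p1 x)}"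
    by (intro pi02_all_imp S computable_intros)
  also have "{x. \<forall>y. S (p2 y) (if p1 y = 0 then p1 x else p2 x) \<longrightarrow>
      S (p2 y) (if p1 y = 0 then p2 x else p1 x)} = decision_problem (obs_eq P)"
  proof (rule set_eqI)
    fix x
    let ?T = "\<lambda>b C. S C (if b = 0 then p1 x else p2 x) \<longrightarrow> S C (if b = 0 then p2 x else p1 x)"
    have "(\<forall>y. ?T (p1 y) (p2 y)) \<longleftrightarrow> (\<forall>C. S C (p1 x) \<longleftrightarrow> S C (p2 x))"
    proof
      assume T: "\<forall>y. ?T (p1 y) (p2 y)"
      show "\<forall>C. S C (p1 x) \<longleftrightarrow> S C (p2 x)"
      proof
        fix C
        from T [THEN spec, of "pr 0 C"] T [THEN spec, of "pr 1 C"]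
        show "S C (p1 x) \<longleftrightarrow> S C (p2 x)" by auto
      qed
    qed simp
    also have "\<dots> \<longleftrightarrow> obs_eq P (dec (p1 x)) (dec (p2 x))"
      unfolding obs_eq_iff_mfill S_def by (metis dec_code)
    finally show "x \<in> {x. \<forall>y. S (p2 y) (if p1 y = 0 then p1 x else p2 x) \<longrightarrow>
      S (p2 y) (if p1 y = 0 then p2 x else p1 x)} \<longleftrightarrow> x \<in> decision_problem (obs_eq P)"
      by (simp add: decision_problem_iff)
  qed
  finally show ?thesis .
qed

section \<open>Hardness\<close>

text \<open>In the recursion, each of the two outer layers is the code of a \<open>Lam\<close>, and
  \<open>Suc (3 * pr 0 r)\<close> is the code of \<open>Var 0\<close> applied to the preceding
  numeral.\<close>

lemma computable_code_num [computable_intros]: "computable f \<Longrightarrow> computable (\<lambda>x. code (num (f x)))"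
proof -
  define c where "c = code (num 0)"
  have "code (num n) =
      rec_nat c (\<lambda>_ r. Suc (Suc (3 * Suc (Suc (3 * Suc (3 * pr 0 r)))))) n" for n
    by (induction n) (simp_all add: c_def)
  moreover assume "computable f"
  ultimately show ?thesis by (simp only:) (intro computable_intros)
qed

theorem obs_eq_hard:
  assumes P: "P \<in> {is_nf, is_hnf, is_whnf}" and A: "pi02 A"
  shows "many_one_reducible A (decision_problem (obs_eq P))"
proof -
  from A obtain R f where f: "recursive_fun 3 f" "\<And>x y z. f [x, y, z] = (if R x y z then 1 else 0)"
    and A: "A = {x. \<forall>y. \<exists>z. R x y z}" unfolding pi02_def by blast
  then obtain F where F: "computes F 3 f" using recursive_fun_computes by blast
  have f01: "f [x, y, z] \<in> {0, 1}" for x y z by (simp add: f(2))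
  \<comment> \<open>Only the numeral \<open>num x\<close> varies with \<open>x\<close>; the code of
    \<open>F\<close> is a constant, so the reduction is computable.\<close>
  let ?r = "\<lambda>x. pr (code (search_tm F x 0 0)) (code stream_tm)"
  have "computable ?r"
    unfolding search_tm_def code_simps(1) by (intro computable_intros)
  then obtain g where g: "recursive_fun 1 g" "\<And>x. g [x] = ?r x" by (auto simp: computable_iff)
  have "x \<in> A \<longleftrightarrow> obs_eq P (search_tm F x 0 0) stream_tm" for x
  proof (cases "x \<in> A")
    case True
    then have "\<exists>z. f [x, k, z] = 1" for k by (simp add: A f(2))
    then have "obs_eq P (search_tm F x 0 0) stream_tm" using F f01 P by (intro obs_eq_search_tm)
    with True show ?thesis by simp
  next
    case False
    then obtain k where "\<And>z. \<not> R x k z" by (auto simp: A)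
    then have "f [x, k, z] = 0" for z by (simp add: f(2))
    then have "\<not> obs_eq P (search_tm F x 0 0) stream_tm"
      using F f01 P by (intro not_obs_eq_search_tm)
    with False show ?thesis by simp
  qed
  then have "x \<in> A \<longleftrightarrow> g [x] \<in> decision_problem (obs_eq P)" for x
    by (simp add: g(2) decision_problem_iff)
  with g(1) show ?thesis unfolding many_one_reducible_def by blast
qed

theorem theorem10:
  "pi02_complete (decision_problem eq_nf) \<and>
   pi02_complete (decision_problem eq_hnf) \<and>
   pi02_complete (decision_problem eq_whnf)"
  unfolding pi02_complete_def eq_nf_def eq_hnf_def eq_whnf_def
  by (intro conjI allI impI pi02_obs_eq obs_eq_hard decidable_nf decidable_hnf decidable_whnf) simp_all

end
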